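(* Let $p>0$, let $N\ge 1$, let $(a_j,|b_j|)\in\mathbb{R}\times[0,+\infty)$, $j=1,\ldots,N$, be pairwise distinct, and set $$R_j(x)=(x-a_j)^2+b_j^2,\qquad D=\mathbb{R}\setminus\{a_j : b_j=0\}.$$ Then any nonzero linear combination (real coefficients, not all zero) of the $2N$ functions $$R_j(x)^{-(p+2)/2},\qquad (x-a_j)\,R_j(x)^{-(p+2)/2},\qquad j=1,\ldots,N,$$ has at most $2N-1$ distinct zeroes in $D$. In particular, when $|b_j|>0$ for all $j$, these $2N$ functions form a Haar system on $\mathbb{R}$.
   Context: A family of $M$ continuous real functions on $\mathbb{R}$ is a Haar system on $\mathbb{R}$ if every linear combination of them with real coefficients not all zero has at most $M-1$ distinct zeroes in $\mathbb{R}$. *)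

theory Defs
  imports "HOL-Analysis.Analysis"
begin

text \<open>
  Families are indexed by a finite set, so that repeated functions are counted
  with multiplicity, and the number M of functions is the cardinality of the index set.
  Finiteness of the zero set is required explicitly because the cardinality of an
  infinite set is 0 by convention.
\<close>

definition haar_system :: "'i set \<Rightarrow> ('i \<Rightarrow> real \<Rightarrow> real) \<Rightarrow> bool" where
  "haar_system I f \<longleftrightarrow>
     finite I \<and>
     (\<forall>i\<in>I. continuous_on UNIV (f i)) \<and>
     (\<forall>c. (\<exists>i\<in>I. c i \<noteq> 0) \<longrightarrow>
        finite {x. (\<Sum>i\<in>I. c i * f i x) = 0} \<and>
        card {x. (\<Sum>i\<in>I. c i * f i x) = 0} \<le> card I - 1)"

end

theory Submission
  imports Defs "HOL-Complex_Analysis.Complex_Analysis" "HOL-Real_Asymp.Real_Asymp"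
begin

text \<open>
  If a nontrivial combination f of the 2N functions vanishes at 2N points of D, then the square matrix
  of their values is singular, so its transpose has a kernel as well: there are weights c y on the 2N
  zeros y, not all zero, with
  \<Sum> c y |z - y|^(-(p+2)) = 0 and \<Sum> c y y |z - y|^(-(p+2)) = 0
  for each of the N distinct points z = a_j + i |b_j| of the closed upper half plane. Such weights are
  excluded by potential theory (dual_system_bound).

  The inversion z \<mapsto> 1 / cnj (z - x0) at a point x0 with c x0 \<noteq> 0 sends the charge at x0 to infinity, where
  it becomes a uniform field. The equations then say that the N image points are critical for
  U(z) = \<kappa> Re z + \<Sum> d x |z - x|^(-p),
  with \<kappa> \<noteq> 0 and at most 2N - 1 charges x on the real axis. With a = Re z and b = Im z, the function U
  solves U_aa + U_bb + (p/b) U_b = 0; it is an axially symmetric harmonic function of "p + 2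
  dimensions". Hence U satisfies a maximum principle, also at points of the axis
  (potential_max_principle), and has no other critical points than saddles (critical_saddle).

  The saddles are counted by lowering the level c of the superlevel sets U > c. By the maximum principle,
  every component of such a set reaches a positive charge or the far right end of the half plane, where
  the uniform field dominates (superlevel_components_reach_sources). At a saddle two components merge: if
  its two ridges were already joined above the level of the saddle, then a loop through the saddle would
  enclose one of its valleys (loop_through_corner_separates), against the minimum principle. Since there
  are P + 1 places to reach if P is the number of positive charges, there are at most P saddles
  (card_saddles_le_positive_charges). Applied to U and to the reflected negative potential, this gives
  at most half as many critical points as charges (twice_card_critical_le_card_charges), so
  2N \<le> 2N - 1, a contradiction.

  That critical points are saddles is seen from the power series of U along rays. Off the axis its leading term
  is the real part of a monomial C h^n with n \<ge> 2. On the axis, criticality includes the vanishing of the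
  second derivatives; there the leading term has degree n \<ge> 3 and is, up to a constant, a Gegenbauer
  polynomial of the cosine of the direction, whose signs alternate often enough by
  Sturm comparison with degree 2 (gegenbauer_alternating_signs).
\<close>

section \<open>Square linear systems and their transposes\<close>

lemma underdetermined_system_nontrivial:
  fixes F :: "'i \<Rightarrow> 'y \<Rightarrow> real"
  assumes "finite I" "finite Y" "card I < card Y"
  shows "\<exists>c. (\<exists>y\<in>Y. c y \<noteq> 0) \<and> (\<forall>i\<in>I. (\<Sum>y\<in>Y. c y * F i y) = 0)"
  using assms
proof (induction I arbitrary: Y F rule: finite_induct)
  case empty
  then have "Y \<noteq> {}" by auto
  then show ?case by (intro exI[of _ "\<lambda>_. 1"]) auto
next
  case (insert i I)
  show ?case
  proof (cases "\<forall>y\<in>Y. F i y = 0")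
    case True
    have "card I < card Y" using insert by auto
    from insert.IH[OF \<open>finite Y\<close> this, of F] obtain c where
      "\<exists>y\<in>Y. c y \<noteq> 0" "\<forall>i\<in>I. (\<Sum>y\<in>Y. c y * F i y) = 0" by blast
    then show ?thesis using True by (intro exI[of _ c]) auto
  next
    case False
    then obtain y0 where y0: "y0 \<in> Y" "F i y0 \<noteq> 0" by blast
    \<comment> \<open>Gaussian elimination of the unknown with index y0 by means of equation i\<close>
    define G where "G k y = F k y - F k y0 * F i y / F i y0" for k y
    have "card I < card (Y - {y0})" using insert y0 by auto
    from insert.IH[OF _ this, of G] insert.prems obtain c where
      c: "\<exists>y\<in>Y - {y0}. c y \<noteq> 0" "\<forall>k\<in>I. (\<Sum>y\<in>Y - {y0}. c y * G k y) = 0" by auto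
    define s where "s = (\<Sum>y\<in>Y - {y0}. c y * F i y)"
    define e where "e = c(y0 := - s / F i y0)"
    have sum_e: "(\<Sum>y\<in>Y. e y * F k y) = (\<Sum>y\<in>Y - {y0}. c y * F k y) - s / F i y0 * F k y0" for k
    proof -
      have "(\<Sum>y\<in>Y. e y * F k y) = e y0 * F k y0 + (\<Sum>y\<in>Y - {y0}. e y * F k y)"
        using y0 insert.prems by (simp add: sum.remove)
      also have "(\<Sum>y\<in>Y - {y0}. e y * F k y) = (\<Sum>y\<in>Y - {y0}. c y * F k y)"
        by (intro sum.cong) (auto simp: e_def)
      finally show ?thesis by (simp add: e_def)
    qed
    have "(\<Sum>y\<in>Y. e y * F k y) = 0" if "k \<in> I" for k
    proof -
      have "0 = (\<Sum>y\<in>Y - {y0}. c y * G k y)" using c that by auto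
      also have "\<dots> = (\<Sum>y\<in>Y - {y0}. c y * F k y) - (\<Sum>y\<in>Y - {y0}. F k y0 / F i y0 * (c y * F i y))"
        by (simp add: G_def right_diff_distrib sum_subtractf mult_ac)
      also have "\<dots> = (\<Sum>y\<in>Y. e y * F k y)"
        by (simp add: sum_e s_def sum_distrib_left sum_distrib_right sum_divide_distrib mult_ac)
      finally show ?thesis by simp
    qed
    moreover have "(\<Sum>y\<in>Y. e y * F i y) = 0"
      using y0 by (simp add: sum_e) (simp add: s_def)
    moreover have "\<exists>y\<in>Y. e y \<noteq> 0" using c by (auto simp: e_def)
    ultimately show ?thesis by (intro exI[of _ e]) auto
  qed
qed

text \<open>
  The equation of an index i0 with a i0 \<noteq> 0 is a consequence of the others, so it can be dropped; what is
  left has more unknowns than equations.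
\<close>

lemma square_system_transpose_kernel:
  fixes F :: "'i \<Rightarrow> 'y \<Rightarrow> real"
  assumes "finite I" "finite Y" "card I = card Y"
    and a: "\<exists>i\<in>I. a i \<noteq> 0" "\<And>y. y \<in> Y \<Longrightarrow> (\<Sum>i\<in>I. a i * F i y) = 0"
  shows "\<exists>c. (\<exists>y\<in>Y. c y \<noteq> 0) \<and> (\<forall>i\<in>I. (\<Sum>y\<in>Y. c y * F i y) = 0)"
proof -
  obtain i0 where i0: "i0 \<in> I" "a i0 \<noteq> 0" using a by blast
  have "card (I - {i0}) < card Y" using i0 assms
    by (metis card_Diff1_less)
  then obtain c where c: "\<exists>y\<in>Y. c y \<noteq> 0" "\<forall>i\<in>I - {i0}. (\<Sum>y\<in>Y. c y * F i y) = 0"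
    using underdetermined_system_nontrivial[of "I - {i0}" Y F] assms by auto
  have "0 = (\<Sum>y\<in>Y. c y * (\<Sum>i\<in>I. a i * F i y))" using a by simp
  also have "\<dots> = (\<Sum>i\<in>I. a i * (\<Sum>y\<in>Y. c y * F i y))"
    unfolding sum_distrib_left by (subst sum.swap) (simp add: mult_ac)
  also have "\<dots> = a i0 * (\<Sum>y\<in>Y. c y * F i0 y)"
    using i0 c assms by (subst sum.remove[of I i0]) auto
  finally have "(\<Sum>y\<in>Y. c y * F i0 y) = 0" using i0 by simp
  then show ?thesis using c by blast
qed

section \<open>Loops with a corner\<close>

text \<open>
  Crossing a loop at a corner changes the winding number by 1, so the two sides of the corner cannot
  both lie outside the loop. Here v points into the sector spanned by u1 and u3, and v' out of it.
\<close>

lemma loop_through_corner_separates: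
  fixes z u1 u3 v v' :: complex
  assumes indep: "Im (cnj u1 * u3) \<noteq> 0"
    and v: "v = of_real s * u1 + of_real t * u3" "s > 0" "t > 0"
    and v': "\<And>s t :: real. s \<ge> 0 \<Longrightarrow> t \<ge> 0 \<Longrightarrow> v' \<noteq> of_real s * u1 + of_real t * u3"
    and \<eta>: "path \<eta>" "pathstart \<eta> = z + u1" "pathfinish \<eta> = z + u3" "z \<notin> path_image \<eta>"
  defines "\<gamma> \<equiv> linepath z (z + u1) +++ \<eta> +++ linepath (z + u3) z"
  shows "\<exists>e>0. \<forall>h::real. 0 < h \<longrightarrow> h < e \<longrightarrow>
           z + of_real h * v \<in> inside (path_image \<gamma>) \<or> z + of_real h * v' \<in> inside (path_image \<gamma>)"
proof -
  let ?a = "z + u1" and ?b = "z + u3"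
  \<comment> \<open>The loop is the sum of a triangle with corner z and a loop \<mu> that stays away from z. The
    winding number of \<mu> is constant near z, that of the triangle jumps across the corner.\<close>
  define \<tau> where "\<tau> = linepath z ?a +++ linepath ?a ?b +++ linepath ?b z"
  define \<mu> where "\<mu> = \<eta> +++ linepath ?b ?a"
  have lin0: "s = 0 \<and> t = 0" if "of_real s * u1 + of_real t * u3 = 0" for s t :: real
  proof -
    have "Im (cnj u1 * (of_real s * u1 + of_real t * u3)) = t * Im (cnj u1 * u3)"
      by (simp add: algebra_simps)
    then have "t = 0" using indep that by simp
    moreover have "u1 \<noteq> 0" using indep by auto
    ultimately show ?thesis using that by simp
  qed
  have lin: "s = s' \<and> t = t'"
    if "of_real s * u1 + of_real t * u3 = of_real s' * u1 + of_real t' * u3" for s t s' t' :: real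
    using lin0[of "s - s'" "t - t'"] that by (simp add: algebra_simps)
  have hull: "w \<in> convex hull {z, ?a, ?b} \<longleftrightarrow>
      (\<exists>s t::real. s \<ge> 0 \<and> t \<ge> 0 \<and> s + t \<le> 1 \<and> w = z + of_real s * u1 + of_real t * u3)" for w
  proof
    assume "w \<in> convex hull {z, ?a, ?b}"
    then obtain p q r where "0 \<le> p" "0 \<le> q" "0 \<le> r" "p + q + r = 1"
        "w = p *\<^sub>R z + q *\<^sub>R ?a + r *\<^sub>R ?b"
      unfolding convex_hull_3 by blast
    moreover from this have p: "p = 1 - q - r" by simp
    ultimately have "w = z + of_real q * u1 + of_real r * u3"
      by (simp add: algebra_simps scaleR_conv_of_real)
    with \<open>0 \<le> p\<close> \<open>0 \<le> q\<close> \<open>0 \<le> r\<close> p show "\<exists>s t::real. s \<ge> 0 \<and> t \<ge> 0 \<and> s + t \<le> 1 \<and> w = z + of_real s * u1 + of_real t * u3"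
      by (intro exI[of _ q] exI[of _ r]) auto
  next
    assume "\<exists>s t::real. s \<ge> 0 \<and> t \<ge> 0 \<and> s + t \<le> 1 \<and> w = z + of_real s * u1 + of_real t * u3"
    then obtain s t :: real where st: "s \<ge> 0" "t \<ge> 0" "s + t \<le> 1" "w = z + of_real s * u1 + of_real t * u3"
      by blast
    then have "w = (1 - s - t) *\<^sub>R z + s *\<^sub>R ?a + t *\<^sub>R ?b"
      by (simp add: algebra_simps scaleR_conv_of_real)
    then show "w \<in> convex hull {z, ?a, ?b}" unfolding convex_hull_3 using st
      by (intro CollectI exI[of _ "1-s-t"] exI[of _ s] exI[of _ t]) auto
  qed
  have ncol: "\<not> collinear {z, ?a, ?b}"
  proof
    assume "collinear {z, ?a, ?b}"
    then have "collinear {?a, z, ?b}" by (simp only: insert_commute)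
    moreover have "collinear {?a, z, ?b} = collinear {0, ?a - z, ?b - z}"
      by (rule collinear_3) (simp add: NO_MATCH_def)
    ultimately have "collinear {0, ?a - z, ?b - z}" by simp
    then have "collinear {0, u1, u3}" by simp
    then consider "u1 = 0" | "u3 = 0" | c where "u3 = c *\<^sub>R u1"
      by (auto simp: collinear_lemma)
    then show False using indep by cases (auto simp: scaleR_conv_of_real)
  qed
  have z_seg: "z \<notin> closed_segment ?a ?b"
  proof
    assume "z \<in> closed_segment ?a ?b"
    then obtain t where "z = (1 - t) *\<^sub>R ?a + t *\<^sub>R ?b" by (auto simp: in_segment)
    then have "of_real (1 - t) * u1 + of_real t * u3 = 0"
      by (simp add: scaleR_conv_of_real algebra_simps)
    from lin0[OF this] show False by auto
  qed
  have "closed (path_image \<mu>)" "z \<notin> path_image \<mu>"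
    using \<eta> z_seg by (auto simp: \<mu>_def path_image_join closed_segment_commute intro!: closed_path_image)
  then obtain e0 where e0: "e0 > 0" "ball z e0 \<inter> path_image \<mu> = {}"
    using open_contains_ball[of "- path_image \<mu>"] by (auto simp: open_Compl) blast
  have v'0: "v' \<noteq> 0" using v'[of 0 0] by simp
  have v0: "v \<noteq> 0" using lin0[of s t] v by auto
  define e where "e = min (e0 / (norm v + norm v')) (1 / (s + t))"
  have "e > 0" using e0 v'0 v by (simp add: e_def add_nonneg_pos)
  moreover have "z + of_real h * v \<in> inside (path_image \<gamma>) \<or> z + of_real h * v' \<in> inside (path_image \<gamma>)"
    if h: "0 < h" "h < e" for h
  proof -
    define w where "w = z + of_real h * v"
    define w' where "w' = z + of_real h * v'"
    have hs: "h * (s + t) < 1" using h v by (simp add: e_def field_simps)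
    have he: "h * (norm v + norm v') < e0"
      using h v'0 by (simp add: e_def add_nonneg_pos pos_less_divide_eq)
    have "h * norm v < e0" "h * norm v' < e0"
      using h by (auto intro!: le_less_trans[OF _ he] simp: distrib_left)
    then have ball: "w \<in> ball z e0" "w' \<in> ball z e0"
      using h by (auto simp: w_def w'_def dist_norm norm_mult)
    have w_eq: "w = z + of_real (h * s) * u1 + of_real (h * t) * u3"
      by (simp add: w_def v algebra_simps)
    have w_int: "w \<in> interior (convex hull {z, ?a, ?b})"
    proof -
      have "w = (1 - h * s - h * t) *\<^sub>R z + (h * s) *\<^sub>R ?a + (h * t) *\<^sub>R ?b"
        by (simp add: w_eq algebra_simps scaleR_conv_of_real)
      moreover have "1 - h * s - h * t > 0" "h * s > 0" "h * t > 0" using hs h v by (auto simp: algebra_simps)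
      ultimately show ?thesis
        by (subst interior_convex_hull_3_minimal[OF ncol])
           (simp, intro CollectI exI[of _ "1 - h * s - h * t"] exI[of _ "h * s"] exI[of _ "h * t"], simp)
    qed
    have w'_out: "w' \<notin> convex hull {z, ?a, ?b}"
    proof
      assume "w' \<in> convex hull {z, ?a, ?b}"
      then obtain s t where "s \<ge> 0" "t \<ge> 0" "w' = z + of_real s * u1 + of_real t * u3"
        by (auto simp: hull)
      then have "v' = of_real (s / h) * u1 + of_real (t / h) * u3" "s / h \<ge> 0" "t / h \<ge> 0"
        using h by (auto simp: w'_def field_simps)
      then show False using v' by blast
    qed
    have tri: "path_image \<tau> \<subseteq> convex hull {z, ?a, ?b}"
      unfolding \<tau>_def
      by (auto simp: path_image_join segment_convex_hull intro: hull_mono[THEN subsetD, rotated])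
    have w'_seg: "w' \<notin> closed_segment z ?a" "w' \<notin> closed_segment ?b z"
      using tri w'_out by (auto simp: \<tau>_def path_image_join)
    have w_seg1: "w \<notin> closed_segment z ?a"
    proof
      assume "w \<in> closed_segment z ?a"
      then obtain x where "w = (1 - x) *\<^sub>R z + x *\<^sub>R ?a" by (auto simp: in_segment)
      then have "of_real (h * s) * u1 + of_real (h * t) * u3 = of_real x * u1 + of_real 0 * u3"
        by (simp add: w_eq scaleR_conv_of_real algebra_simps)
      from lin[OF this] show False using h v by auto
    qed
    have w_seg2: "w \<notin> closed_segment ?b z"
    proof
      assume "w \<in> closed_segment ?b z"
      then obtain x where "w = (1 - x) *\<^sub>R ?b + x *\<^sub>R z" by (auto simp: in_segment)
      then have "of_real (h * s) * u1 + of_real (h * t) * u3 = of_real 0 * u1 + of_real (1-x) * u3"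
        by (simp add: w_eq scaleR_conv_of_real algebra_simps)
      from lin[OF this] show False using h v by auto
    qed
    have mu: "w \<notin> path_image \<eta>" "w' \<notin> path_image \<eta>"
       "w \<notin> closed_segment ?a ?b" "w' \<notin> closed_segment ?a ?b"
      using ball e0 by (auto simp: \<mu>_def path_image_join \<eta> closed_segment_commute)
    have split: "winding_number \<gamma> x = winding_number \<mu> x + winding_number \<tau> x"
      if "x \<notin> closed_segment z ?a" "x \<notin> closed_segment ?b z"
         "x \<notin> path_image \<eta>" "x \<notin> closed_segment ?a ?b" for x
    proof -
      have "winding_number (linepath ?b ?a) x = - winding_number (linepath ?a ?b) x"
        using winding_number_reversepath[of "linepath ?a ?b" x] that by simp
      then show ?thesis using that \<eta>
        by (simp add: \<gamma>_def \<mu>_def \<tau>_def winding_number_join path_image_join closed_segment_commute)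
    qed
    have loop: "path \<mu>" "pathfinish \<mu> = pathstart \<mu>" using \<eta> by (auto simp: \<mu>_def)
    have "winding_number \<mu> w = winding_number \<mu> w'"
      by (rule winding_number_eq[OF loop ball]) (use e0 in auto)
    moreover have "winding_number \<tau> w \<noteq> 0"
      unfolding \<tau>_def winding_number_triangle[OF w_int] by simp
    moreover have "winding_number \<tau> w' = 0"
      by (rule winding_number_zero_outside[OF _ convex_convex_hull _ w'_out tri]) (auto simp: \<tau>_def)
    ultimately have ne: "winding_number \<gamma> w \<noteq> 0 \<or> winding_number \<gamma> w' \<noteq> 0"
      using split[OF w_seg1 w_seg2 mu(1,3)] split[OF w'_seg mu(2,4)] by auto
    have "path \<gamma>" "pathfinish \<gamma> = pathstart \<gamma>" using \<eta> by (auto simp: \<gamma>_def)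
    from winding_number_zero_in_outside[OF this] ne
    have "w \<notin> outside (path_image \<gamma>) \<or> w' \<notin> outside (path_image \<gamma>)" by blast
    moreover have "w \<notin> path_image \<gamma>" "w' \<notin> path_image \<gamma>"
      using w_seg1 w_seg2 w'_seg mu \<eta> by (auto simp: \<gamma>_def path_image_join)
    ultimately show ?thesis by (auto simp: inside_outside w_def w'_def)
  qed
  ultimately show ?thesis by blast
qed

section \<open>Axially symmetric potentials and their maximum principle\<close>

text \<open>
  A uniform field of strength \<kappa> along the real axis, together with charges d x at the points x of the axis.
  The kernel is the Newtonian one of dimension p + 2, for real p.
\<close>

definition potential :: "real \<Rightarrow> real \<Rightarrow> real set \<Rightarrow> (real \<Rightarrow> real) \<Rightarrow> complex \<Rightarrow> real" where
  "potential p \<kappa> X d z = \<kappa> * Re z + (\<Sum>x\<in>X. d x * cmod (z - of_real x) powr (-p))"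

text \<open>
  The real axis belongs to this region: points a_j with b_j = 0 lead to critical points there.
\<close>

definition charge_free :: "real set \<Rightarrow> complex set" where
  "charge_free X = {z. 0 \<le> Im z} - of_real ` X"

lemma potential_Complex:
  "potential p \<kappa> X d (Complex a b) =
     \<kappa> * a + (\<Sum>x\<in>X. d x * ((a - x)\<^sup>2 + b\<^sup>2) powr (-p/2))"
proof -
  have "cmod (Complex a b - of_real x) powr (-p) = ((a - x)\<^sup>2 + b\<^sup>2) powr (-p/2)" for x
    by (simp add: cmod_def powr_powr flip: powr_half_sqrt)
  then show ?thesis by (simp add: potential_def)
qed

lemma continuous_on_potential: "continuous_on (- of_real ` X) (potential p \<kappa> X d)"
  unfolding potential_def by (auto intro!: continuous_intros)

lemma potential_uminus: "potential p (-\<kappa>) X (\<lambda>x. - d x) z = - potential p \<kappa> X d z"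
  by (simp add: potential_def sum_negf)

lemma local_max_second_derivative:
  fixes f f' :: "real \<Rightarrow> real"
  assumes "e > 0"
    and f: "\<And>x. \<bar>x - x0\<bar> < e \<Longrightarrow> (f has_real_derivative f' x) (at x)"
    and f': "(f' has_real_derivative c) (at x0)"
    and max: "\<And>x. \<bar>x - x0\<bar> < e \<Longrightarrow> f x \<le> f x0"
  shows "f' x0 = 0" "c \<le> 0"
proof -
  show 0: "f' x0 = 0"
    by (rule DERIV_local_max[OF f \<open>e > 0\<close>]) (use \<open>e > 0\<close> max in \<open>auto simp: abs_minus_commute\<close>)
  show "c \<le> 0"
  proof (rule ccontr)
    assume "\<not> c \<le> 0"
    then obtain e' where e': "e' > 0" "\<And>h. 0 < h \<Longrightarrow> h < e' \<Longrightarrow> f' x0 < f' (x0 + h)"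
      using DERIV_pos_inc_right[OF f'] by auto
    define h where "h = min e e' / 2"
    have h: "0 < h" "h < e" "h < e'" using \<open>e > 0\<close> e' by (auto simp: h_def)
    have "f x0 < f (x0 + h)"
    proof (rule DERIV_pos_imp_increasing_open[of x0 "x0 + h" f])
      show "x0 < x0 + h" using h by simp
      show "\<exists>y. DERIV f x :> y \<and> 0 < y" if "x0 < x" "x < x0 + h" for x
        using f[of x] e'(2)[of "x - x0"] that h 0 by (intro exI[of _ "f' x"]) auto
      show "continuous_on {x0..x0 + h} f"
        using h by (intro DERIV_continuous_on[of _ _ f'] DERIV_subset[OF f]) auto
    qed
    then show False using max[of "x0 + h"] h by simp
  qed
qed

lemma has_real_derivative_powr_const:
  assumes "(g has_real_derivative m) (at x)" "g x > 0"
  shows "((\<lambda>x. g x powr r) has_real_derivative r * g x powr (r - 1) * m) (at x)"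
  using DERIV_fun_powr[OF assms, of r] by simp

text \<open>
  At a maximum of U + \<epsilon> a^2 the derivatives have signs that contradict the differential
  equation, in which \<epsilon> a^2 contributes the positive amount 2 \<epsilon>. For points on the real axis the hypothesis
  only concerns the half of the ball in the upper half plane.
\<close>

lemma potential_no_interior_max:
  assumes "p > 0" "\<epsilon> > 0" "e > 0" "finite X"
    and m: "m \<in> charge_free X"
    and max: "\<And>w. w \<in> ball m e \<Longrightarrow> 0 \<le> Im w \<Longrightarrow>
                potential p \<kappa> X d w + \<epsilon> * (Re w)\<^sup>2 \<le> potential p \<kappa> X d m + \<epsilon> * (Re m)\<^sup>2"
  shows False
proof -
  obtain a0 b0 where m_eq: "m = Complex a0 b0" by (cases m)
  define q where "q = p / 2"
  have q: "q > 0" using assms by (simp add: q_def)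
  have b0: "b0 \<ge> 0" using m by (simp add: charge_free_def m_eq)
  define y0 where "y0 = b0\<^sup>2"
  define R where "R x = (a0 - x)\<^sup>2 + y0" for x
  have R_pos: "R x > 0" if "x \<in> X" for x
  proof -
    have "a0 \<noteq> x \<or> b0 \<noteq> 0" using m that by (auto simp: charge_free_def m_eq complex_eq_iff)
    then show ?thesis by (auto simp: R_def y0_def add_pos_nonneg add_nonneg_pos)
  qed
  \<comment> \<open>the second derivative along the axis\<close>
  define f where "f a = \<kappa> * a + (\<Sum>x\<in>X. d x * ((a - x)\<^sup>2 + y0) powr (-q)) + \<epsilon> * a\<^sup>2" for a
  define f' where "f' a = \<kappa> + (\<Sum>x\<in>X. d x * (- q * ((a - x)\<^sup>2 + y0) powr (-q-1) * (2 * (a - x)))) + \<epsilon> * (2 * a)" for a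
  define f2 where "f2 = (\<Sum>x\<in>X. d x * (- 2 * q * R x powr (-q-1) + 4 * q * (q+1) * (a0 - x)\<^sup>2 * R x powr (-q-2))) + 2 * \<epsilon>"
  have ev: "eventually (\<lambda>a. \<forall>x\<in>X. (a - x)\<^sup>2 + y0 > 0) (nhds a0)"
    using R_pos by (intro eventually_ball_finite \<open>finite X\<close> ballI order_tendstoD(1)[where y = "R _"])
                   (auto simp: R_def intro!: tendsto_eq_intros filterlim_ident)
  then obtain e1 where e1: "e1 > 0" "\<And>a x. \<bar>a - a0\<bar> < e1 \<Longrightarrow> x \<in> X \<Longrightarrow> (a - x)\<^sup>2 + y0 > 0"
    by (auto simp: eventually_nhds_metric dist_real_def)
  have dR: "((\<lambda>a. ((a - x)\<^sup>2 + y0) powr r) has_real_derivative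
               r * ((a - x)\<^sup>2 + y0) powr (r - 1) * (2 * (a - x))) (at a)"
    if "(a - x)\<^sup>2 + y0 > 0" for a x r
    by (rule has_real_derivative_powr_const) (use that in \<open>auto intro!: derivative_eq_intros\<close>)
  have dsq: "((\<lambda>a. a\<^sup>2) has_real_derivative 2 * a) (at a)"
    and dlin: "((\<lambda>a. 2 * (a - x)) has_real_derivative 2) (at a)" for a x :: real
    by (auto intro!: derivative_eq_intros)
  have f: "(f has_real_derivative f' a) (at a)" if "\<bar>a - a0\<bar> < min e e1" for a
  proof -
    have "(f has_real_derivative \<kappa> * 1 +
        (\<Sum>x\<in>X. d x * (- q * ((a - x)\<^sup>2 + y0) powr (-q-1) * (2 * (a - x)))) + \<epsilon> * (2 * a)) (at a)"
      unfolding f_def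
      by (intro DERIV_add DERIV_sum DERIV_cmult DERIV_ident dR dsq) (use e1 that in auto)
    then show ?thesis by (simp add: f'_def)
  qed
  have f': "(f' has_real_derivative f2) (at a0)"
  proof -
    have "(f' has_real_derivative 0 +
        (\<Sum>x\<in>X. d x * ((- q * ((-q-1) * ((a0 - x)\<^sup>2 + y0) powr (-q-1-1) * (2 * (a0 - x)))) * (2 * (a0 - x))
            + 2 * (- q * ((a0 - x)\<^sup>2 + y0) powr (-q-1)))) + \<epsilon> * (2 * 1)) (at a0)"
      unfolding f'_def
      by (intro DERIV_add DERIV_sum DERIV_cmult DERIV_mult DERIV_ident DERIV_const dR dlin)
         (use R_pos in \<open>auto simp: R_def\<close>)
    moreover have "-q-1-1 = -q-2" by simp
    ultimately show ?thesis
      by (simp add: f2_def R_def power2_eq_square algebra_simps)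
  qed
  have f_max: "f a \<le> f a0" if "\<bar>a - a0\<bar> < min e e1" for a
  proof -
    have "Complex a b0 \<in> ball m e" using that by (simp add: m_eq dist_norm cmod_def abs_minus_commute)
    from max[OF this] b0 show ?thesis
      by (simp add: m_eq potential_Complex f_def q_def y0_def)
  qed
  have "min e e1 > 0" using \<open>e > 0\<close> e1 by simp
  from local_max_second_derivative(2)[OF this f f' f_max] have f2: "f2 \<le> 0" .
  \<comment> \<open>The derivatives in the squared distance y from the axis: in this variable the axis is an
    ordinary boundary point, where a one-sided first derivative is all that is needed.\<close>
  define g where "g y = (\<Sum>x\<in>X. d x * ((a0 - x)\<^sup>2 + y) powr (-q))" for y
  define g' where "g' y = (\<Sum>x\<in>X. d x * (- q * ((a0 - x)\<^sup>2 + y) powr (-q-1)))" for y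
  define g2 where "g2 = (\<Sum>x\<in>X. d x * (q * (q+1) * R x powr (-q-2)))"
  have "eventually (\<lambda>y. \<forall>x\<in>X. (a0 - x)\<^sup>2 + y > 0) (nhds y0)"
    using R_pos by (intro eventually_ball_finite \<open>finite X\<close> ballI order_tendstoD(1)[where y = "R _"])
                   (auto simp: R_def intro!: tendsto_eq_intros filterlim_ident)
  then obtain e2 where e2: "e2 > 0" "\<And>y x. \<bar>y - y0\<bar> < e2 \<Longrightarrow> x \<in> X \<Longrightarrow> (a0 - x)\<^sup>2 + y > 0"
    by (auto simp: eventually_nhds_metric dist_real_def)
  have dR: "((\<lambda>y. ((a0 - x)\<^sup>2 + y) powr r) has_real_derivative
               r * ((a0 - x)\<^sup>2 + y) powr (r - 1) * 1) (at y)"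
    if "(a0 - x)\<^sup>2 + y > 0" for y x r
    by (rule has_real_derivative_powr_const) (use that in \<open>auto intro!: derivative_eq_intros\<close>)
  have g: "(g has_real_derivative g' y) (at y)" if "\<bar>y - y0\<bar> < e2" for y
  proof -
    have "(g has_real_derivative (\<Sum>x\<in>X. d x * (- q * ((a0 - x)\<^sup>2 + y) powr (-q-1) * 1))) (at y)"
      unfolding g_def by (intro DERIV_sum DERIV_cmult dR) (use e2 that in auto)
    then show ?thesis by (simp add: g'_def)
  qed
  have g': "(g' has_real_derivative g2) (at y0)"
  proof -
    have "(g' has_real_derivative
            (\<Sum>x\<in>X. d x * (- q * ((-q-1) * ((a0 - x)\<^sup>2 + y0) powr (-q-1-1) * 1)))) (at y0)"
      unfolding g'_def by (intro DERIV_sum DERIV_cmult dR) (use R_pos in \<open>auto simp: R_def\<close>)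
    moreover have "-q-1-1 = -q-2" by simp
    ultimately show ?thesis
      by (simp add: g2_def R_def algebra_simps)
  qed
  have "(sqrt \<longlongrightarrow> sqrt y0) (nhds y0)"
    using isCont_real_sqrt[of y0] by (simp add: isCont_def tendsto_at_iff_tendsto_nhds)
  then have "eventually (\<lambda>y. dist (sqrt y) (sqrt y0) < e) (nhds y0)"
    using \<open>e > 0\<close> by (rule tendstoD)
  then obtain e3 where e3: "e3 > 0" "\<And>y. \<bar>y - y0\<bar> < e3 \<Longrightarrow> \<bar>sqrt y - b0\<bar> < e"
    using b0 by (auto simp: eventually_nhds_metric dist_real_def y0_def)
  have g_max: "g y \<le> g y0" if "\<bar>y - y0\<bar> < e3" "y \<ge> 0" for y
  proof -
    have "Complex a0 (sqrt y) \<in> ball m e"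
      using e3 that by (simp add: m_eq dist_norm cmod_def abs_minus_commute)
    from max[OF this] that show ?thesis
      by (simp add: m_eq potential_Complex g_def q_def y0_def)
  qed
  have *: "g' y0 \<le> 0 \<and> y0 * g2 \<le> 0"
  proof (cases "y0 = 0")
    case True
    have "g' y0 \<le> 0"
    proof (rule ccontr)
      assume "\<not> g' y0 \<le> 0"
      then obtain e' where e': "e' > 0" "\<And>h. 0 < h \<Longrightarrow> h < e' \<Longrightarrow> g y0 < g (y0 + h)"
        using DERIV_pos_inc_right[OF g[of y0]] e2 by auto
      define h where "h = min e' e3 / 2"
      have "0 < h" "h < e'" "h < e3" using e' e3 by (auto simp: h_def)
      then show False using g_max[of "y0 + h"] e'(2)[of h] True by auto
    qed
    then show ?thesis using True by simp
  next
    case False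
    then have y0: "y0 > 0" by (simp add: y0_def)
    define e' where "e' = min e2 (min e3 y0)"
    have e': "e' > 0" using e2 e3 y0 by (simp add: e'_def)
    have gd: "(g has_real_derivative g' y) (at y)" if "\<bar>y - y0\<bar> < e'" for y
      using that by (intro g) (simp add: e'_def)
    have gm: "g y \<le> g y0" if "\<bar>y - y0\<bar> < e'" for y
      using that by (intro g_max) (auto simp: e'_def)
    have "g' y0 = 0" "g2 \<le> 0"
      using local_max_second_derivative[OF e' gd g' gm] by blast+
    then show ?thesis using y0 by (simp add: mult_nonneg_nonpos)
  qed
  \<comment> \<open>the differential equation in the variables a and y\<close>
  have "f2 - 2 * \<epsilon> + 4 * (y0 * g2) + (2 + 4 * q) * g' y0 =
     (\<Sum>x\<in>X. d x * (- 2 * q * R x powr (-q-1) + 4 * q * (q+1) * (a0 - x)\<^sup>2 * R x powr (-q-2))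
         + 4 * y0 * (d x * (q * (q+1) * R x powr (-q-2)))
         + (2 + 4 * q) * (d x * (- q * R x powr (-q-1))))"
    unfolding sum.distrib sum_distrib_left[symmetric] by (simp add: f2_def g2_def g'_def R_def)
  also have "\<dots> = (\<Sum>x\<in>X. 0)"
  proof (intro sum.cong refl)
    fix x assume "x \<in> X"
    have "R x powr (-q-1) = R x powr 1 * R x powr (-q-2)"
      unfolding powr_add[symmetric] by (rule arg_cong) simp
    also have "R x powr 1 = (a0 - x)\<^sup>2 + y0" using R_pos[OF \<open>x \<in> X\<close>] by (simp add: R_def)
    finally have "R x powr (-q-1) = ((a0 - x)\<^sup>2 + y0) * R x powr (-q-2)" .
    then show "d x * (- 2 * q * R x powr (-q-1) + 4 * q * (q+1) * (a0 - x)\<^sup>2 * R x powr (-q-2))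
         + 4 * y0 * (d x * (q * (q+1) * R x powr (-q-2)))
         + (2 + 4 * q) * (d x * (- q * R x powr (-q-1))) = 0"
      by (simp only:) (simp add: algebra_simps)
  qed
  finally have "f2 - 2 * \<epsilon> + 4 * (y0 * g2) + (2 + 4 * q) * g' y0 = 0" by simp
  moreover have "(2 + 4 * q) * g' y0 \<le> 0" using * q by (simp add: mult_nonneg_nonpos)
  ultimately show False using f2 * \<open>\<epsilon> > 0\<close>
    by linarith
qed

text \<open>
  The set K stands for the closure of a component of a superlevel set. Its points above the level c
  are relatively interior in the half plane, so that the axis does not count as boundary.
\<close>

lemma potential_max_principle:
  assumes "p > 0" "finite X"
    and K: "compact K" "K \<subseteq> charge_free X"
    and nbh: "\<And>z. z \<in> K \<Longrightarrow> potential p \<kappa> X d z > c \<Longrightarrow> \<exists>e>0. ball z e \<inter> {w. 0 \<le> Im w} \<subseteq> K"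
    and z: "z \<in> K"
  shows "potential p \<kappa> X d z \<le> c"
proof (rule ccontr)
  let ?U = "potential p \<kappa> X d"
  assume "\<not> ?U z \<le> c"
  then have z_gt: "?U z > c" by simp
  obtain B where B: "B > 0" "\<And>w. w \<in> K \<Longrightarrow> norm w \<le> B"
    using compact_imp_bounded[OF K(1)] by (auto simp: bounded_pos)
  define \<epsilon> where "\<epsilon> = (?U z - c) / (2 * B\<^sup>2)"
  have \<epsilon>: "\<epsilon> > 0" using z_gt B by (simp add: \<epsilon>_def)
  have \<epsilon>B: "\<epsilon> * B\<^sup>2 < ?U z - c" using z_gt B by (simp add: \<epsilon>_def field_simps)
  define V where "V w = ?U w + \<epsilon> * (Re w)\<^sup>2" for w
  have "continuous_on K V"
    unfolding V_def using K(2)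
    by (intro continuous_intros continuous_on_subset[OF continuous_on_potential])
       (auto simp: charge_free_def)
  then obtain m where m: "m \<in> K" "\<And>w. w \<in> K \<Longrightarrow> V w \<le> V m"
    using continuous_attains_sup[OF K(1), of V] z by auto
  have "(Re m)\<^sup>2 \<le> B\<^sup>2"
    using B(2)[OF m(1)] abs_Re_le_cmod[of m] by (intro abs_le_square_iff[THEN iffD1]) auto
  then have "\<epsilon> * (Re m)\<^sup>2 \<le> \<epsilon> * B\<^sup>2" using \<epsilon> by simp
  moreover have "V z \<le> V m" using m z by simp
  moreover have "\<epsilon> * (Re z)\<^sup>2 \<ge> 0" using \<epsilon> by simp
  ultimately have "?U m > c" using \<epsilon>B by (simp add: V_def)
  then obtain e where "e > 0" "ball m e \<inter> {w. 0 \<le> Im w} \<subseteq> K" using nbh m by blast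
  with m have "\<And>w. w \<in> ball m e \<Longrightarrow> 0 \<le> Im w \<Longrightarrow> V w \<le> V m" by blast
  then show False
    using potential_no_interior_max[OF \<open>p > 0\<close> \<epsilon> \<open>e > 0\<close> \<open>finite X\<close>, of m \<kappa> d] m K(2)
    by (auto simp: V_def)
qed

section \<open>Components of superlevel sets\<close>

definition superlevel :: "real \<Rightarrow> real \<Rightarrow> real set \<Rightarrow> (real \<Rightarrow> real) \<Rightarrow> real \<Rightarrow> complex set" where
  "superlevel p \<kappa> X d c = {z \<in> charge_free X. potential p \<kappa> X d z > c}"

text \<open>
  Far away the uniform field dominates: the potential is large on the right and small on the left,
  and it increases along horizontal lines far above the axis.
\<close>

lemma potential_at_infinity:
  assumes "p > 0" "\<kappa> > 0" "finite X"
  obtains T where "T > 0" "\<And>x. x \<in> X \<Longrightarrow> \<bar>x\<bar> < T"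
    "\<And>z. Re z \<ge> T \<Longrightarrow> potential p \<kappa> X d z > C"
    "\<And>z. Re z \<le> -T \<Longrightarrow> potential p \<kappa> X d z < - C"
    "\<And>z s. Im z \<ge> T \<Longrightarrow> s \<ge> 0 \<Longrightarrow> potential p \<kappa> X d z \<le> potential p \<kappa> X d (z + of_real s)"
proof -
  define A where "A = (\<Sum>x\<in>X. \<bar>d x\<bar>)"
  define B where "B = (\<Sum>x\<in>X. \<bar>x\<bar>)"
  have A: "A \<ge> 0" and B: "B \<ge> 0" by (auto simp: A_def B_def sum_nonneg)
  have xB: "\<bar>x\<bar> \<le> B" if "x \<in> X" for x
    unfolding B_def using that assms by (intro member_le_sum) auto
  \<comment> \<open>At distance at least L from every charge, the horizontal derivative of the charge terms is
    below \<kappa> in absolute value, and T is so large that the uniform field dominates.\<close>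
  define L where "L = 1 + p * A / \<kappa>"
  have L: "L \<ge> 1" using assms A by (simp add: L_def)
  have L': "p * A < \<kappa> * L" using assms by (simp add: L_def field_simps)
  define T where "T = B + L + (\<bar>C\<bar> + A + 1) / \<kappa>"
  have T: "T \<ge> B + L" "\<kappa> * T \<ge> \<bar>C\<bar> + A + 1"
    using assms A B L by (auto simp: T_def field_simps)
  have far: "cmod (z - of_real x) \<ge> L" if "cmod z \<ge> T" "x \<in> X" for z x
    using norm_triangle_ineq2[of z "of_real x"] xB[OF that(2)] that(1) T by simp
  have small: "\<bar>\<Sum>x\<in>X. d x * cmod (z - of_real x) powr (-p)\<bar> \<le> A" if "cmod z \<ge> T" for z
  proof -
    have "\<bar>d x * cmod (z - of_real x) powr (-p)\<bar> \<le> \<bar>d x\<bar>" if "x \<in> X" for x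
    proof -
      have "cmod (z - of_real x) powr (-p) \<le> 1"
        using far[OF \<open>cmod z \<ge> T\<close> that] L assms powr_mono[of "-p" 0 "cmod (z - of_real x)"]
        by (simp split: if_splits)
      then show ?thesis by (simp add: abs_mult mult_left_le)
    qed
    then show ?thesis unfolding A_def by (intro order.trans[OF sum_abs] sum_mono) auto
  qed
  show thesis
  proof (rule that[of T])
    show "T > 0" using T(1) B L by linarith
    show "\<bar>x\<bar> < T" if "x \<in> X" for x using xB[OF that] T L by linarith
    show "potential p \<kappa> X d z > C" if "Re z \<ge> T" for z
    proof -
      have "cmod z \<ge> T" using that complex_Re_le_cmod[of z] by linarith
      moreover have "\<kappa> * Re z \<ge> \<kappa> * T" using that assms by simp
      ultimately show ?thesis using small[of z] T unfolding potential_def by linarith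
    qed
    show "potential p \<kappa> X d z < - C" if "Re z \<le> -T" for z
    proof -
      have "cmod z \<ge> T" using that abs_Re_le_cmod[of z] by linarith
      moreover have "\<kappa> * Re z \<le> \<kappa> * (-T)" using that assms by (intro mult_left_mono) auto
      then have "\<kappa> * Re z \<le> - (\<kappa> * T)" by simp
      ultimately show ?thesis using small[of z] T unfolding potential_def by linarith
    qed
    show "potential p \<kappa> X d z \<le> potential p \<kappa> X d (z + of_real s)" if Im: "Im z \<ge> T" and s: "s \<ge> 0" for z s
    proof -
      define b where "b = Im z"
      have b: "b > 0" using that \<open>T > 0\<close> by (simp add: b_def)
      define f where "f a = \<kappa> * a + (\<Sum>x\<in>X. d x * ((a - x)\<^sup>2 + b\<^sup>2) powr (-p/2))" for a
      define f' where "f' a = \<kappa> * 1 + (\<Sum>x\<in>X. d x * ((-p/2) * ((a - x)\<^sup>2 + b\<^sup>2) powr (-p/2 - 1) * (2 * (a - x))))" for a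
      have R_pos: "(a - x)\<^sup>2 + b\<^sup>2 > 0" for a x using b by (simp add: add_nonneg_pos)
      have dR: "((\<lambda>a. ((a - x)\<^sup>2 + b\<^sup>2) powr r) has_real_derivative
               r * ((a - x)\<^sup>2 + b\<^sup>2) powr (r - 1) * (2 * (a - x))) (at a)" for a x r
        by (rule has_real_derivative_powr_const) (use R_pos in \<open>auto intro!: derivative_eq_intros\<close>)
      have f: "(f has_real_derivative f' a) (at a)" for a
        unfolding f_def f'_def by (intro DERIV_add DERIV_sum DERIV_cmult DERIV_ident dR)
      have f'_pos: "f' a \<ge> 0" for a
      proof -
        have "\<bar>d x * ((-p/2) * ((a - x)\<^sup>2 + b\<^sup>2) powr (-p/2 - 1) * (2 * (a - x)))\<bar> \<le> \<bar>d x\<bar> * (p / L)"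
          if "x \<in> X" for x
        proof -
          define r where "r = sqrt ((a - x)\<^sup>2 + b\<^sup>2)"
          have "r \<ge> b" unfolding r_def using b by (intro real_le_rsqrt) auto
          then have r: "r \<ge> L" using Im T B by (simp add: b_def)
          have "\<bar>a - x\<bar> \<le> r" unfolding r_def by (intro real_le_rsqrt) auto
          moreover have "((a - x)\<^sup>2 + b\<^sup>2) powr (-p/2 - 1) = r powr (-p - 2)"
            unfolding r_def by (simp add: powr_powr field_simps flip: powr_half_sqrt)
          ultimately have "\<bar>(-p/2) * ((a - x)\<^sup>2 + b\<^sup>2) powr (-p/2 - 1) * (2 * (a - x))\<bar> \<le> p * (r powr (-p-2) * r)"
            using assms by (simp add: abs_mult mult_left_mono)
          also have "r powr (-p-2) * r = r powr (-p-2+1)"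
            unfolding powr_add using r L by simp
          also have "p * r powr (-p-2+1) \<le> p * r powr (-1)"
            using r L assms by (intro mult_left_mono powr_mono) auto
          also have "\<dots> \<le> p / L"
            using r L assms by (simp add: powr_minus_divide frac_le)
          finally show ?thesis unfolding abs_mult[of "d x"] by (rule mult_left_mono) simp
        qed
        then have "\<bar>\<Sum>x\<in>X. d x * ((-p/2) * ((a - x)\<^sup>2 + b\<^sup>2) powr (-p/2 - 1) * (2 * (a - x)))\<bar> \<le> A * (p / L)"
          unfolding A_def sum_distrib_right by (intro order.trans[OF sum_abs] sum_mono)
        also have "\<dots> \<le> \<kappa>" using L' L by (simp add: field_simps)
        finally show ?thesis unfolding f'_def by linarith
      qed
      have "f (Re z) \<le> f (Re z + s)"
        by (rule DERIV_nonneg_imp_nondecreasing[of "Re z" "Re z + s" f]) (use s f f'_pos in auto)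
      moreover have "z = Complex (Re z) b" "z + of_real s = Complex (Re z + s) b"
        by (auto simp: b_def complex_eq_iff)
      ultimately show ?thesis
        by (metis potential_Complex f_def)
    qed
  qed
qed

lemma potential_near_charges:
  assumes "p > 0" "finite X"
  obtains \<rho> where "\<rho> > 0"
    "\<And>x z. x \<in> X \<Longrightarrow> 0 < cmod (z - of_real x) \<Longrightarrow> cmod (z - of_real x) \<le> \<rho> \<Longrightarrow> d x > 0 \<Longrightarrow>
        potential p \<kappa> X d z > C"
    "\<And>x z. x \<in> X \<Longrightarrow> 0 < cmod (z - of_real x) \<Longrightarrow> cmod (z - of_real x) \<le> \<rho> \<Longrightarrow> d x < 0 \<Longrightarrow>
        potential p \<kappa> X d z < -C"
proof -
  have "\<exists>\<rho>>0. \<forall>z. 0 < cmod (z - of_real x) \<longrightarrow> cmod (z - of_real x) \<le> \<rho> \<longrightarrow>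
          (d x > 0 \<longrightarrow> potential p \<kappa> X d z > C) \<and> (d x < 0 \<longrightarrow> potential p \<kappa> X d z < -C)"
    if x: "x \<in> X" for x
  proof (cases "d x = 0")
    case False
    define h where "h z = potential p \<kappa> (X - {x}) d z" for z
    have split: "potential p \<kappa> X d z = d x * cmod (z - of_real x) powr (-p) + h z" for z
      using x assms by (simp add: potential_def h_def sum.remove)
    have "isCont h (of_real x)"
      unfolding h_def
      by (rule continuous_on_interior[OF continuous_on_potential])
         (use assms in \<open>auto intro!: interiorI[of "- of_real ` (X - {x})"] open_Compl finite_imp_closed\<close>)
    then obtain \<rho>1 where \<rho>1: "\<rho>1 > 0" "\<And>z. cmod (z - of_real x) < \<rho>1 \<Longrightarrow> \<bar>h z - h x\<bar> < 1"
      unfolding continuous_at_eps_delta by (auto simp: dist_norm dest: spec[of _ 1])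
    define M where "M = (\<bar>C\<bar> + \<bar>h x\<bar> + 1) / \<bar>d x\<bar>"
    have "eventually (\<lambda>r. r powr (-p) > M) (at_right 0)"
      using assms(1) by real_asymp
    then obtain \<rho>2 where \<rho>2: "\<rho>2 > 0" "\<And>r. 0 < r \<Longrightarrow> r < \<rho>2 \<Longrightarrow> r powr (-p) > M"
      by (auto simp: eventually_at_right_field)
    define \<rho> where "\<rho> = min \<rho>1 \<rho>2 / 2"
    have \<rho>: "\<rho> > 0" "\<rho> < \<rho>1" "\<rho> < \<rho>2" using \<rho>1 \<rho>2 by (auto simp: \<rho>_def)
    show ?thesis
    proof (intro exI[of _ \<rho>] conjI allI impI)
      show "\<rho> > 0" by fact
      fix z assume z: "0 < cmod (z - of_real x)" "cmod (z - of_real x) \<le> \<rho>"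
      have h: "\<bar>h z - h x\<bar> < 1" using \<rho> z by (intro \<rho>1) auto
      have "cmod (z - of_real x) powr (-p) > M" using \<rho> z by (intro \<rho>2) auto
      then have big: "\<bar>d x\<bar> * cmod (z - of_real x) powr (-p) > \<bar>C\<bar> + \<bar>h x\<bar> + 1"
        using False by (simp add: M_def field_simps)
      show "potential p \<kappa> X d z > C" if "d x > 0"
        using big h that unfolding split by auto
      show "potential p \<kappa> X d z < -C" if "d x < 0"
        using big h that unfolding split by auto
    qed
  qed (auto intro: exI[of _ 1])
  then obtain r where r: "\<And>x. x \<in> X \<Longrightarrow> r x > 0"
    "\<And>x z. x \<in> X \<Longrightarrow> 0 < cmod (z - of_real x) \<Longrightarrow> cmod (z - of_real x) \<le> r x \<Longrightarrow>
        (d x > 0 \<longrightarrow> potential p \<kappa> X d z > C) \<and> (d x < 0 \<longrightarrow> potential p \<kappa> X d z < -C)"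
    by metis
  define \<rho> where "\<rho> = Min (insert 1 (r ` X))"
  have "\<rho> > 0" using r assms by (auto simp: \<rho>_def)
  moreover have "\<rho> \<le> r x" if "x \<in> X" for x using that assms by (auto simp: \<rho>_def)
  ultimately show thesis using r(2) by (intro that[of \<rho>]) (meson order.trans)+
qed

text \<open>
  The sources S are one point above each positive charge and one point far to the right. They can be
  chosen uniformly for all levels in a bounded range.
\<close>

lemma superlevel_components_reach_sources:
  assumes p: "p > 0" and \<kappa>: "\<kappa> > 0" and X: "finite X" and d: "\<And>x. x \<in> X \<Longrightarrow> d x \<noteq> 0"
  obtains S where "finite S" "S \<noteq> {}" "card S \<le> Suc (card {x \<in> X. d x > 0})" "S \<subseteq> superlevel p \<kappa> X d C"
    "\<And>c w. \<bar>c\<bar> \<le> C \<Longrightarrow> w \<in> superlevel p \<kappa> X d c \<Longrightarrow> \<exists>A\<in>S. path_component (superlevel p \<kappa> X d c) w A"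
proof -
  let ?U = "potential p \<kappa> X d"
  obtain T where T: "T > 0" "\<And>x. x \<in> X \<Longrightarrow> \<bar>x\<bar> < T"
    "\<And>z. Re z \<ge> T \<Longrightarrow> ?U z > C" "\<And>z. Re z \<le> -T \<Longrightarrow> ?U z < - C"
    "\<And>z s. Im z \<ge> T \<Longrightarrow> s \<ge> 0 \<Longrightarrow> ?U z \<le> ?U (z + of_real s)"
    using potential_at_infinity[OF p \<kappa> X, where d = d and C = C] by blast
  obtain \<rho> where \<rho>: "\<rho> > 0"
    "\<And>x z. x \<in> X \<Longrightarrow> 0 < cmod (z - of_real x) \<Longrightarrow> cmod (z - of_real x) \<le> \<rho> \<Longrightarrow> d x > 0 \<Longrightarrow> ?U z > C"
    "\<And>x z. x \<in> X \<Longrightarrow> 0 < cmod (z - of_real x) \<Longrightarrow> cmod (z - of_real x) \<le> \<rho> \<Longrightarrow> d x < 0 \<Longrightarrow> ?U z < -C"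
    using potential_near_charges[OF p X, where d = d and \<kappa> = \<kappa> and C = C] by blast
  define src where "src x = Complex x \<rho>" for x
  have src_dist: "src x - of_real x = \<i> * of_real \<rho>" for x by (simp add: src_def complex_eq_iff)
  define S where "S = insert (of_real T) (src ` {x \<in> X. d x > 0})"
  have right: "z \<in> superlevel p \<kappa> X d c" if "Re z \<ge> T" "Im z \<ge> 0" "c \<le> C" for z c
    using that T(2)[of "Re z"] T(3)[of z] by (auto simp: superlevel_def charge_free_def)
  have "S \<subseteq> superlevel p \<kappa> X d C"
  proof -
    have "src x \<in> superlevel p \<kappa> X d C" if "x \<in> X" "d x > 0" for x
    proof -
      have "?U (src x) > C" using \<rho> that by (intro \<rho>(2)[of x]) (auto simp: src_dist norm_mult)
      moreover have "src x \<in> charge_free X" using \<rho> by (auto simp: charge_free_def src_def complex_eq_iff)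
      ultimately show ?thesis by (simp add: superlevel_def)
    qed
    then show ?thesis using right[of "of_real T" C] T by (auto simp: S_def)
  qed
  moreover have "card S \<le> Suc (card {x \<in> X. d x > 0})"
  proof -
    have "card (src ` {x \<in> X. d x > 0}) \<le> card {x \<in> X. d x > 0}" using X by (intro card_image_le) auto
    moreover have "card S \<le> Suc (card (src ` {x \<in> X. d x > 0}))"
      unfolding S_def using X by (subst card_insert_if) auto
    ultimately show ?thesis by linarith
  qed
  moreover have "\<exists>A\<in>S. path_component (superlevel p \<kappa> X d c) w A"
    if c: "\<bar>c\<bar> \<le> C" and w: "w \<in> superlevel p \<kappa> X d c" for c w
  proof (rule ccontr)
    let ?W = "superlevel p \<kappa> X d c"
    assume "\<not> ?thesis"
    then have no_source: "\<And>A. A \<in> S \<Longrightarrow> \<not> path_component ?W w A" by blast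
    \<comment> \<open>A component P without a source stays in a compact box that avoids all charges; this
      contradicts the maximum principle.\<close>
    define P where "P = path_component_set ?W w"
    have P_W: "v \<in> ?W" if "v \<in> P" for v
      using that path_component_mem by (auto simp: P_def)
    have P_step: "v' \<in> P" if "v \<in> P" "closed_segment v v' \<subseteq> ?W" for v v'
      using that path_component_linepath[of v v' ?W] path_component_trans[of ?W w v v'] by (simp add: P_def)
    have P_S: "A \<notin> P" if "A \<in> S" for A using no_source that by (auto simp: P_def)
    have Re_less: "Re v < T" if v: "v \<in> P" for v
    proof (rule ccontr)
      assume "\<not> Re v < T"
      moreover have "Im v \<ge> 0" using P_W[OF v] by (auto simp: superlevel_def charge_free_def)
      moreover have "convex {z. Re z \<ge> T \<and> Im z \<ge> 0}"
        by (intro convex_Int[of "{z. Re z \<ge> T}" "{z. Im z \<ge> 0}", folded Collect_conj_eq] convex_halfspace_Re_ge convex_halfspace_Im_ge)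
      ultimately have "closed_segment v (of_real T) \<subseteq> {z. Re z \<ge> T \<and> Im z \<ge> 0}"
        by (intro closed_segment_subset) auto
      then have "closed_segment v (of_real T) \<subseteq> ?W" using right[of _ c] c by auto
      from P_step[OF v this] P_S show False by (auto simp: S_def)
    qed
    have Re_greater: "Re v > -T" if "v \<in> P" for v
      using P_W[OF that] T(4)[of v] c by (force simp: superlevel_def)
    \<comment> \<open>High above the axis the potential increases to the right, so a point of P there could be
      moved into the region of the source at infinity.\<close>
    have Im_less: "Im v < T" if v: "v \<in> P" for v
    proof (rule ccontr)
      assume Im: "\<not> Im v < T"
      have "closed_segment v (v + of_real (2 * T)) \<subseteq> ?W"
      proof
        fix y assume "y \<in> closed_segment v (v + of_real (2 * T))"
        then obtain t where t: "0 \<le> t" "t \<le> 1" "y = (1 - t) *\<^sub>R v + t *\<^sub>R (v + of_real (2 * T))"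
          by (auto simp: in_segment)
        then have y: "y = v + of_real (t * (2 * T))" by (simp add: scaleR_conv_of_real algebra_simps)
        have "?U v \<le> ?U y" unfolding y using Im t T(1) by (intro T(5)) auto
        then have "?U y > c" using P_W[OF v] by (auto simp: superlevel_def)
        moreover have "Im y > 0" using Im T(1) by (simp add: y)
        then have "y \<in> charge_free X" by (auto simp: charge_free_def)
        ultimately show "y \<in> ?W" by (simp add: superlevel_def)
      qed
      from Re_less[OF P_step[OF v this]] Re_greater[OF v] show False by simp
    qed
    have off: "cmod (v - of_real x) > \<rho>" if v: "v \<in> P" and x: "x \<in> X" for v x
    proof (rule ccontr)
      assume "\<not> cmod (v - of_real x) > \<rho>"
      then have near: "cmod (v - of_real x) \<le> \<rho>" by simp
      have v': "v \<noteq> of_real x" "Im v \<ge> 0" "?U v > c"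
        using P_W[OF v] x by (auto simp: superlevel_def charge_free_def)
      then have "\<not> d x < 0" using \<rho>(3)[OF x _ near] c by auto
      then have dx: "d x > 0" using d[OF x] by simp
      have "closed_segment v (src x) \<subseteq> ?W"
      proof
        fix y assume y: "y \<in> closed_segment v (src x)"
        then obtain t where t: "0 \<le> t" "t \<le> 1" "y = (1 - t) *\<^sub>R v + t *\<^sub>R src x"
          by (auto simp: in_segment)
        have "closed_segment v (src x) \<subseteq> cball (of_real x) \<rho>"
          using near \<rho>(1)
          by (intro closed_segment_subset)
             (auto simp: dist_norm norm_minus_commute[of "of_real x"] src_dist norm_mult)
        with y have ny: "cmod (y - of_real x) \<le> \<rho>"
          by (auto simp: dist_norm norm_minus_commute[of "of_real x"])
        have *: "y \<noteq> of_real x' \<and> Im y \<ge> 0 " if "t > 0" for x'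
        proof -
          have "Im y > 0" using t that \<rho>(1) v' by (simp add: src_def add_nonneg_pos)
          then show ?thesis by auto
        qed
        have "y \<in> charge_free X \<and> y \<noteq> of_real x"
        proof (cases "t = 0")
          case True
          then show ?thesis using t v' P_W[OF v] by (auto simp: superlevel_def)
        next
          case False
          then show ?thesis using * t by (auto simp: charge_free_def)
        qed
        moreover from this have "?U y > C" using ny dx x by (intro \<rho>(2)[of x]) auto
        ultimately show "y \<in> ?W" using c by (simp add: superlevel_def)
      qed
      from P_step[OF v this] P_S[of "src x"] x dx show False by (auto simp: S_def)
    qed
    define box where "box = {z. 0 \<le> Im z} \<inter> {z. Im z \<le> T} \<inter> {z. -T \<le> Re z} \<inter> {z. Re z \<le> T}
        \<inter> (\<Inter>x\<in>X. {z. \<rho> \<le> cmod (z - of_real x)})"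
    have "closed box"
      unfolding box_def by (intro closed_Int closed_INT ballI closed_Collect_le continuous_intros)
    moreover have "P \<subseteq> box"
    proof
      fix v assume v: "v \<in> P"
      have "Im v \<ge> 0" using P_W[OF v] by (auto simp: superlevel_def charge_free_def)
      with Re_less[OF v] Re_greater[OF v] Im_less[OF v] off[OF v] show "v \<in> box"
        by (auto simp: box_def less_imp_le)
    qed
    ultimately have KB: "closure P \<subseteq> box" by (rule closure_minimal[rotated])
    have "bounded box"
    proof (rule boundedI)
      fix z assume "z \<in> box"
      then have "\<bar>Re z\<bar> \<le> T" "\<bar>Im z\<bar> \<le> T" by (auto simp: box_def)
      then show "norm z \<le> T + T" using cmod_le[of z] by linarith
    qed
    then have K: "compact (closure P)"
      using KB bounded_subset by (auto simp: compact_eq_bounded_closed)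
    have K2: "closure P \<subseteq> charge_free X"
    proof
      fix v assume "v \<in> closure P"
      then have "v \<in> box" using KB by blast
      then have "Im v \<ge> 0" "\<And>x. x \<in> X \<Longrightarrow> cmod (v - of_real x) \<ge> \<rho>" by (auto simp: box_def)
      with \<rho>(1) show "v \<in> charge_free X" unfolding charge_free_def by force
    qed
    have "w \<in> P" using w by (simp add: P_def path_component_refl)
    then have "?U w \<le> c"
    proof (intro potential_max_principle[OF p X K K2] subsetD[OF closure_subset])
      fix z assume z: "z \<in> closure P" "?U z > c"
      have "open (- of_real ` X :: complex set)" using X by (auto intro!: open_Compl finite_imp_closed)
      then have "open ((- of_real ` X) \<inter> ?U -` {c<..})"
        by (intro continuous_open_preimage continuous_on_potential) auto
      moreover have "z \<in> (- of_real ` X) \<inter> ?U -` {c<..}" using z K2 by (auto simp: charge_free_def)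
      ultimately obtain e where e: "e > 0" "ball z e \<subseteq> (- of_real ` X) \<inter> ?U -` {c<..}"
        by (meson open_contains_ball)
      have sub: "ball z e \<inter> {w. 0 \<le> Im w} \<subseteq> ?W"
        using e by (auto simp: superlevel_def charge_free_def)
      obtain v where v: "v \<in> P" "dist v z < e" using z e closure_approachable by blast
      then have v': "v \<in> ball z e \<inter> {w. 0 \<le> Im w}"
        using P_W[OF v(1)] by (auto simp: superlevel_def charge_free_def dist_commute)
      have "convex (ball z e \<inter> {w. 0 \<le> Im w})" by (intro convex_Int convex_ball convex_halfspace_Im_ge)
      then have "y \<in> P" if "y \<in> ball z e \<inter> {w. 0 \<le> Im w}" for y
        using P_step[OF v(1), of y] closed_segment_subset[OF v' that] sub by blast
      then show "\<exists>e>0. ball z e \<inter> {w. 0 \<le> Im w} \<subseteq> closure P"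
        using e closure_subset by (intro exI[of _ e]) blast
    qed auto
    then show False using w by (simp add: superlevel_def)
  qed
  moreover have "finite S" "S \<noteq> {}" using X by (auto simp: S_def)
  ultimately show thesis using that by blast
qed

section \<open>Merging of components at saddles\<close>

text \<open>
  Two ridges start at z in the directions u1 and u3 and are separated by a valley in the direction v. On
  the other side, in the direction v', there is either a second valley or the lower half plane; the latter is
  the case of a point on the real axis.
\<close>

definition saddle :: "real \<Rightarrow> real \<Rightarrow> real set \<Rightarrow> (real \<Rightarrow> real) \<Rightarrow> complex \<Rightarrow> bool" where
  "saddle p \<kappa> X d z \<longleftrightarrow> (\<exists>u1 u3 v v'. Im (cnj u1 * u3) \<noteq> 0 \<and>
     (\<exists>s>0. \<exists>t>0. v = of_real s * u1 + of_real t * u3) \<and>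
     (\<forall>s\<ge>0. \<forall>t\<ge>0. v' \<noteq> of_real s * u1 + of_real t * u3) \<and>
     (\<exists>e>0. \<forall>h. 0 < h \<and> h \<le> e \<longrightarrow>
        z + of_real h * u1 \<in> superlevel p \<kappa> X d (potential p \<kappa> X d z) \<and>
        z + of_real h * u3 \<in> superlevel p \<kappa> X d (potential p \<kappa> X d z) \<and>
        potential p \<kappa> X d (z + of_real h * v) < potential p \<kappa> X d z \<and>
        (potential p \<kappa> X d (z + of_real h * v') < potential p \<kappa> X d z \<or> Im (z + of_real h * v') < 0)))"

text \<open>
  The inside of a compact set in the closed half plane lies in the open half plane, away from all charges,
  so the maximum principle applies to the negative potential there.
\<close>

lemma potential_min_principle_inside:
  assumes p: "p > 0" and X: "finite X" and \<Gamma>: "compact \<Gamma>" "\<Gamma> \<subseteq> charge_free X"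
    and ge: "\<And>w. w \<in> \<Gamma> \<Longrightarrow> potential p \<kappa> X d w \<ge> c"
    and w: "w \<in> inside \<Gamma>"
  shows "Im w > 0" "potential p \<kappa> X d w \<ge> c"
proof -
  have "convex {z. 0 \<le> Im z}" by (rule convex_halfspace_Im_ge)
  moreover have "\<Gamma> \<subseteq> {z. 0 \<le> Im z}" using \<Gamma> by (auto simp: charge_free_def)
  ultimately have "- {z. 0 \<le> Im z} \<subseteq> outside \<Gamma>" by (rule outside_subset_convex)
  then have sub: "inside \<Gamma> \<subseteq> {z. 0 \<le> Im z}" using inside_Int_outside[of \<Gamma>] by blast
  have op: "open (inside \<Gamma>)" using \<Gamma> by (intro open_inside compact_imp_closed)
  have pos: "Im v > 0" if v: "v \<in> inside \<Gamma>" for v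
  proof -
    obtain e where e: "e > 0" "cball v e \<subseteq> inside \<Gamma>" using op v open_contains_cball by blast
    have "v - \<i> * of_real e \<in> cball v e" using e by (simp add: dist_norm norm_mult)
    then have "v - \<i> * of_real e \<in> {z. 0 \<le> Im z}" using e sub by blast
    then show ?thesis using e by simp
  qed
  show "Im w > 0" using pos w by blast
  have fr: "closure (inside \<Gamma>) \<subseteq> inside \<Gamma> \<union> \<Gamma>"
    using frontier_inside_subset[of \<Gamma>] \<Gamma> closure_Un_frontier[of "inside \<Gamma>"] compact_imp_closed by blast
  have "inside \<Gamma> \<subseteq> charge_free X" using pos by (force simp: charge_free_def)
  then have K: "closure (inside \<Gamma>) \<subseteq> charge_free X" using fr \<Gamma> by blast
  have cK: "compact (closure (inside \<Gamma>))"
    using bounded_inside[OF compact_imp_bounded[OF \<Gamma>(1)]] by (simp only: compact_closure)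
  have "potential p (- \<kappa>) X (\<lambda>x. - d x) w \<le> - c"
  proof (rule potential_max_principle[OF p X cK K])
    fix z assume z: "z \<in> closure (inside \<Gamma>)" "potential p (- \<kappa>) X (\<lambda>x. - d x) z > - c"
    then have "z \<notin> \<Gamma>" using ge[of z] by (auto simp: potential_uminus)
    then have "z \<in> inside \<Gamma>" using fr z by blast
    then obtain e where "e > 0" "ball z e \<subseteq> inside \<Gamma>" using op open_contains_ball by blast
    then show "\<exists>e>0. ball z e \<inter> {w. 0 \<le> Im w} \<subseteq> closure (inside \<Gamma>)"
      using closure_subset by (intro exI[of _ e]) blast
  qed (use w closure_subset in blast)
  then show "potential p \<kappa> X d w \<ge> c" by (simp add: potential_uminus)
qed

text \<open>
  A connection of the ridges not below the level of z would, together with the two ridges, form a loop through z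
  that encloses points of a valley or of the lower half plane. The first contradicts the minimum
  principle, the second the position of the loop.
\<close>

lemma saddle_ridges_not_joined:
  assumes p: "p > 0" and X: "finite X" and z: "z \<in> charge_free X" and sad: "saddle p \<kappa> X d z"
  defines "U \<equiv> potential p \<kappa> X d"
  obtains a b where "a \<in> superlevel p \<kappa> X d (U z)" "b \<in> superlevel p \<kappa> X d (U z)"
    "closed_segment z a \<subseteq> insert z (superlevel p \<kappa> X d (U z))"
    "closed_segment z b \<subseteq> insert z (superlevel p \<kappa> X d (U z))"
    "\<not> path_component ({w \<in> charge_free X. U w \<ge> U z} - {z}) a b"
proof -
  let ?W = "superlevel p \<kappa> X d (U z)"
  obtain u1 u3 v v' where sd: "Im (cnj u1 * u3) \<noteq> 0 \<and>
    (\<exists>s>0. \<exists>t>0. v = of_real s * u1 + of_real t * u3) \<and>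
    (\<forall>s\<ge>0. \<forall>t\<ge>0. v' \<noteq> of_real s * u1 + of_real t * u3) \<and>
    (\<exists>e>0. \<forall>h. 0 < h \<and> h \<le> e \<longrightarrow>
        z + of_real h * u1 \<in> ?W \<and> z + of_real h * u3 \<in> ?W \<and>
        U (z + of_real h * v) < U z \<and> (U (z + of_real h * v') < U z \<or> Im (z + of_real h * v') < 0))"
    using sad[unfolded saddle_def, folded U_def] by (elim exE) (rule that)
  note indep = sd[THEN conjunct1] and ex_v = sd[THEN conjunct2, THEN conjunct1]
    and all_v' = sd[THEN conjunct2, THEN conjunct2, THEN conjunct1]
    and ex_e = sd[THEN conjunct2, THEN conjunct2, THEN conjunct2]
  obtain s t where v: "s > 0" "t > 0" "v = of_real s * u1 + of_real t * u3" using ex_v by blast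
  have v': "v' \<noteq> of_real s * u1 + of_real t * u3" if "s \<ge> 0" "t \<ge> 0" for s t
    using all_v' that by blast
  obtain e where e: "e > 0" and arms: "\<And>h. 0 < h \<Longrightarrow> h \<le> e \<Longrightarrow>
        z + of_real h * u1 \<in> ?W \<and> z + of_real h * u3 \<in> ?W \<and>
        U (z + of_real h * v) < U z \<and> (U (z + of_real h * v') < U z \<or> Im (z + of_real h * v') < 0)"
    using ex_e by blast
  define a where "a = z + of_real e * u1"
  define b where "b = z + of_real e * u3"
  have seg: "closed_segment z (z + of_real e * u) \<subseteq> insert z ?W"
    if "\<And>h. 0 < h \<Longrightarrow> h \<le> e \<Longrightarrow> z + of_real h * u \<in> ?W" for u
  proof
    fix y assume "y \<in> closed_segment z (z + of_real e * u)"
    then obtain t where t: "0 \<le> t" "t \<le> 1" "y = (1 - t) *\<^sub>R z + t *\<^sub>R (z + of_real e * u)"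
      by (auto simp: in_segment)
    then have y: "y = z + of_real (t * e) * u" by (simp add: scaleR_conv_of_real algebra_simps)
    show "y \<in> insert z ?W"
      using that[of "t * e"] t e y by (cases "t = 0") (auto simp: mult_le_cancel_right1)
  qed
  have seg_a: "closed_segment z a \<subseteq> insert z ?W" unfolding a_def by (rule seg) (use arms in blast)
  have seg_b: "closed_segment z b \<subseteq> insert z ?W" unfolding b_def by (rule seg) (use arms in blast)
  have "\<not> path_component ({w \<in> charge_free X. U w \<ge> U z} - {z}) a b"
  proof
    assume "path_component ({w \<in> charge_free X. U w \<ge> U z} - {z}) a b"
    then obtain \<eta> where \<eta>: "path \<eta>" "path_image \<eta> \<subseteq> {w \<in> charge_free X. U w \<ge> U z} - {z}"
      "pathstart \<eta> = a" "pathfinish \<eta> = b" by (auto simp: path_component_def)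
    define \<gamma> where "\<gamma> = linepath z a +++ \<eta> +++ linepath b z"
    have "\<exists>e'>0. \<forall>h::real. 0 < h \<longrightarrow> h < e' \<longrightarrow>
           z + of_real h * v \<in> inside (path_image \<gamma>) \<or> z + of_real h * v' \<in> inside (path_image \<gamma>)"
      unfolding \<gamma>_def a_def b_def
    proof (rule loop_through_corner_separates)
      show "Im (cnj (of_real e * u1) * (of_real e * u3)) \<noteq> 0"
      proof -
        have "cnj (of_real e * u1) * (of_real e * u3) = of_real (e * e) * (cnj u1 * u3)" by simp
        also have "Im \<dots> = e * e * Im (cnj u1 * u3)"
          by (simp only: times_complex.sel Re_complex_of_real Im_complex_of_real)
        finally show ?thesis using indep e by simp
      qed
      show "v = of_real (s / e) * (of_real e * u1) + of_real (t / e) * (of_real e * u3)"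
        using e v by simp
      show "v' \<noteq> of_real s * (of_real e * u1) + of_real t * (of_real e * u3)" if "s \<ge> 0" "t \<ge> 0" for s t
        using v'[of "s * e" "t * e"] that e by (simp add: mult.assoc)
    qed (use e v \<eta> in \<open>auto simp: a_def b_def\<close>)
    then obtain e' where e': "e' > 0" "\<And>h. 0 < h \<Longrightarrow> h < e' \<Longrightarrow>
      z + of_real h * v \<in> inside (path_image \<gamma>) \<or> z + of_real h * v' \<in> inside (path_image \<gamma>)" by blast
    define h where "h = min e e' / 2"
    have h: "0 < h" "h \<le> e" "h < e'" using e e' by (auto simp: h_def)
    have "path \<gamma>" unfolding \<gamma>_def using \<eta> by simp
    then have cp: "compact (path_image \<gamma>)" by (rule compact_path_image)
    have "path_image \<gamma> = closed_segment z a \<union> path_image \<eta> \<union> closed_segment z b"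
      unfolding \<gamma>_def using \<eta> by (auto simp: path_image_join closed_segment_commute)
    moreover have "insert z ?W \<subseteq> {w \<in> charge_free X. U w \<ge> U z}"
      using z by (auto simp: superlevel_def U_def)
    ultimately have im: "path_image \<gamma> \<subseteq> {w \<in> charge_free X. U w \<ge> U z}"
      using seg_a seg_b \<eta>(2) by blast
    have "Im w > 0 \<and> U w \<ge> U z" if "w \<in> inside (path_image \<gamma>)" for w
      using potential_min_principle_inside[OF p X cp _ _ that, where \<kappa> = \<kappa> and d = d and c = "U z"] im by (auto simp: U_def)
    then show False using e'(2)[OF h(1,3)] arms[OF h(1,2)] by fastforce
  qed
  moreover have "a \<in> ?W" "b \<in> ?W" using arms[of e] e by (auto simp: a_def b_def)
  ultimately show thesis using seg_a seg_b that by blast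
qed

lemma card_path_components_decrease:
  assumes S: "finite S" "S \<subseteq> K" and KL: "K \<subseteq> L"
    and A: "A \<in> S" "B \<in> S" "\<not> path_component K A B" "path_component L A B"
  shows "card (path_component_set L ` S) < card (path_component_set K ` S)"
proof -
  have eq: "path_component_set M x = path_component_set M y \<longleftrightarrow> path_component M x y"
    if "x \<in> M" "y \<in> M" for M :: "'a set" and x y
    using that path_component_eq_eq[of M x y] by (auto simp: path_component_refl)
  \<comment> \<open>Every component of the larger set that meets S comes from one of the smaller set.\<close>
  define r where "r C = path_component_set L (SOME x. x \<in> S \<and> path_component_set K x = C)" for C
  have r: "r (path_component_set K x) = path_component_set L x" if "x \<in> S" for x
  proof -
    define y where "y = (SOME y. y \<in> S \<and> path_component_set K y = path_component_set K x)"
    have "y \<in> S \<and> path_component_set K y = path_component_set K x"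
      unfolding y_def by (rule someI[of _ x]) (use that in auto)
    then have "path_component L y x"
      using eq[of y K x] S that KL path_component_of_subset by blast
    then show ?thesis using eq[of y L x] S KL that \<open>y \<in> S \<and> _\<close> unfolding r_def y_def by blast
  qed
  have im: "path_component_set L ` S = r ` (path_component_set K ` S)"
    using r by (force simp: image_image)
  have "\<not> inj_on r (path_component_set K ` S)"
  proof
    assume "inj_on r (path_component_set K ` S)"
    moreover have "r (path_component_set K A) = r (path_component_set K B)"
      using A S KL eq[of A L B] by (auto simp: r)
    ultimately have "path_component_set K A = path_component_set K B"
      using A by (auto dest: inj_onD)
    then show False using A S eq[of A K B] by blast
  qed
  then show ?thesis unfolding im using S
    by (metis card_image_le eq_card_imp_inj_on finite_imageI le_neq_implies_less)
qed

text \<open>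
  Each saddle lowers the number of components that contain sources by at least one; that number is at most
  the number of positive charges plus 1 at the beginning and at least 1 at the end. Saddles of
  equal height are treated one after the other, which is why the sets considered are superlevel sets with
  finitely many saddles added.
\<close>

theorem card_saddles_le_positive_charges:
  assumes p: "p > 0" and \<kappa>: "\<kappa> > 0" and X: "finite X" and d: "\<And>x. x \<in> X \<Longrightarrow> d x \<noteq> 0"
    and Z: "finite Z" "\<And>z. z \<in> Z \<Longrightarrow> z \<in> charge_free X" "\<And>z. z \<in> Z \<Longrightarrow> saddle p \<kappa> X d z"
  shows "card Z \<le> card {x \<in> X. d x > 0}"
proof -
  let ?U = "potential p \<kappa> X d" and ?W = "superlevel p \<kappa> X d"
  define C where "C = Max (insert 0 ((\<lambda>z. \<bar>?U z\<bar>) ` Z))"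
  have C: "\<bar>?U z\<bar> \<le> C" if "z \<in> Z" for z using that Z by (auto simp: C_def)
  obtain S where S: "finite S" "S \<noteq> {}" "card S \<le> Suc (card {x \<in> X. d x > 0})" "S \<subseteq> ?W C"
    and reach: "\<And>c w. \<bar>c\<bar> \<le> C \<Longrightarrow> w \<in> ?W c \<Longrightarrow> \<exists>A\<in>S. path_component (?W c) w A"
    by (rule superlevel_components_reach_sources[OF p \<kappa> X d, where C = C]) (assumption, rule that)
  \<comment> \<open>The superlevel set at the height of a saddle, enlarged by the saddles already absorbed, separates
    the two ridges; adding the saddle itself joins them, and both ridges lead to sources.\<close>
  have step: "\<exists>A\<in>S. \<exists>B\<in>S. \<not> path_component (Y \<union> ?W (?U z)) A B \<and> path_component (insert z Y \<union> ?W (?U z)) A B"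
    if z: "z \<in> Z" and Y: "Y \<subseteq> Z - {z}" "\<And>y. y \<in> Y \<Longrightarrow> ?U y \<ge> ?U z" for z Y
  proof -
    let ?K = "Y \<union> ?W (?U z)" and ?L = "insert z Y \<union> ?W (?U z)"
    obtain a b where ab: "a \<in> ?W (?U z)" "b \<in> ?W (?U z)"
      "closed_segment z a \<subseteq> insert z (?W (?U z))" "closed_segment z b \<subseteq> insert z (?W (?U z))"
      "\<not> path_component ({w \<in> charge_free X. ?U w \<ge> ?U z} - {z}) a b"
      using saddle_ridges_not_joined[OF p X Z(2) Z(3), OF z z] by blast
    obtain A B where AB: "A \<in> S" "path_component (?W (?U z)) a A" "B \<in> S" "path_component (?W (?U z)) b B"
      using reach[OF C[OF z]] ab by meson
    have "?K \<subseteq> {w \<in> charge_free X. ?U w \<ge> ?U z} - {z}"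
      using Y Z by (auto simp: superlevel_def)
    then have nK: "\<not> path_component ?K a b" using ab(5) path_component_of_subset by blast
    have aK: "path_component ?K a A" "path_component ?K b B"
      using AB path_component_of_subset[of "?W (?U z)" ?K] by auto
    have "\<not> path_component ?K A B"
      using nK aK path_component_trans path_component_sym by metis
    moreover have "path_component ?L A B"
    proof -
      have "path_component ?L a A" "path_component ?L b B"
        using aK path_component_of_subset[of ?K ?L] by auto
      moreover have "path_component ?L z a" "path_component ?L z b"
        using ab by (auto intro!: path_component_linepath)
      ultimately show ?thesis using path_component_trans path_component_sym by metis
    qed
    ultimately show ?thesis using AB by blast
  qed
  \<comment> \<open>The saddles are absorbed in the order of decreasing height.\<close>
  have "Y \<subseteq> Z \<longrightarrow> (\<forall>c. c \<le> C \<longrightarrow> (\<forall>y\<in>Y. c \<le> ?U y) \<longrightarrow>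
           card (path_component_set (Y \<union> ?W c) ` S) + card Y \<le> card S)" if "finite Y" for Y
    using that
  proof (induction Y rule: finite_ranking_induct[where f = "\<lambda>z. - ?U z"])
    case empty
    then show ?case using S card_image_le by auto
  next
    case (insert z Y)
    show ?case
    proof (cases "z \<in> Y")
      case True
      then show ?thesis using insert by (simp add: insert_absorb)
    next
      case False
      show ?thesis
      proof (intro impI allI)
        fix c assume sub: "insert z Y \<subseteq> Z" and c: "c \<le> C" "\<forall>y\<in>insert z Y. c \<le> ?U y"
        have zZ: "z \<in> Z" using sub by auto
        let ?K = "Y \<union> ?W (?U z)" and ?M = "insert z Y \<union> ?W (?U z)" and ?L = "insert z Y \<union> ?W c"
        obtain A B where AB: "A \<in> S" "B \<in> S" "\<not> path_component ?K A B" "path_component ?M A B"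
          using step[of z Y] sub False insert.hyps(2) by (metis Diff_empty insert_subset neg_le_iff_le subset_Diff_insert)
        have "?W (?U z) \<subseteq> ?W c" using c by (auto simp: superlevel_def)
        then have "?M \<subseteq> ?L" "?K \<subseteq> ?L" by auto
        moreover have "?W C \<subseteq> ?W (?U z)" using C[OF zZ] by (auto simp: superlevel_def)
        then have "S \<subseteq> ?K" using S by auto
        ultimately have "card (path_component_set ?L ` S) < card (path_component_set ?K ` S)"
          using AB S path_component_of_subset[OF _ AB(4)] by (intro card_path_components_decrease) auto
        moreover have "card (path_component_set ?K ` S) + card Y \<le> card S"
          using insert.IH sub C[OF zZ] insert.hyps(2) by auto
        ultimately show "card (path_component_set ?L ` S) + card (insert z Y) \<le> card S"
          using False insert.hyps(1) by simp
      qed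
    qed
  qed
  moreover have "C \<ge> 0" using Z(1) by (simp add: C_def)
  moreover have "- C \<le> ?U z" if "z \<in> Z" for z using C[OF that] by linarith
  ultimately have "card (path_component_set (Z \<union> ?W (-C)) ` S) + card Z \<le> card S"
    using Z(1) by simp
  moreover have "card (path_component_set (Z \<union> ?W (-C)) ` S) > 0"
    using S by (simp add: card_gt_0_iff)
  ultimately show ?thesis using S(3) by linarith
qed

section \<open>Gegenbauer functions and Sturm comparison\<close>

lemma of_real_gbinomial: "of_real (a gchoose k) = (of_real a gchoose k :: complex)"
  by (simp add: gbinomial_prod_rev)

text \<open>
  This is (-1)^n C_n^(q)(cos \<theta>) for the Gegenbauer polynomial C_n^(q), in the form in which it arises from
  the product of the binomial series of (1 + h)^(-q) and (1 + cnj h)^(-q).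
\<close>

definition gegenbauer :: "real \<Rightarrow> nat \<Rightarrow> real \<Rightarrow> real" where
  "gegenbauer q n \<theta> = (\<Sum>k\<le>n. (-q gchoose k) * (-q gchoose (n - k)) * cos ((real k - real (n - k)) * \<theta>))"

definition gegenbauer' :: "real \<Rightarrow> nat \<Rightarrow> real \<Rightarrow> real" where
  "gegenbauer' q n \<theta> = (\<Sum>k\<le>n. (-q gchoose k) * (-q gchoose (n - k)) *
      (- (real k - real (n - k)) * sin ((real k - real (n - k)) * \<theta>)))"

definition gegenbauer'' :: "real \<Rightarrow> nat \<Rightarrow> real \<Rightarrow> real" where
  "gegenbauer'' q n \<theta> = (\<Sum>k\<le>n. (-q gchoose k) * (-q gchoose (n - k)) *
      (- (real k - real (n - k))\<^sup>2 * cos ((real k - real (n - k)) * \<theta>)))"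

lemma has_real_derivative_gegenbauer:
  "(gegenbauer q n has_real_derivative gegenbauer' q n \<theta>) (at \<theta>)"
proof -
  have "((\<lambda>\<theta>. cos (m * \<theta>)) has_real_derivative (- m * sin (m * \<theta>))) (at \<theta>)" for m :: real
    by (auto intro!: derivative_eq_intros)
  then show ?thesis
    unfolding gegenbauer_def[abs_def] gegenbauer'_def by (intro DERIV_sum DERIV_cmult)
qed

lemma has_real_derivative_gegenbauer':
  "(gegenbauer' q n has_real_derivative gegenbauer'' q n \<theta>) (at \<theta>)"
proof -
  have "((\<lambda>\<theta>. - m * sin (m * \<theta>)) has_real_derivative (- m\<^sup>2 * cos (m * \<theta>))) (at \<theta>)" for m :: real
    by (auto intro!: derivative_eq_intros simp: power2_eq_square)
  then show ?thesis
    unfolding gegenbauer'_def[abs_def] gegenbauer''_def by (intro DERIV_sum DERIV_cmult)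
qed

lemma gbinomial_neg_Suc: "(real k + 1) * (-q gchoose Suc k) = - (q + real k) * (-q gchoose k)"
  for q :: real
  using gbinomial_mult_1[of "-q" k] by (simp add: algebra_simps)

lemma gegenbauer_ode:
  "sin \<theta> * gegenbauer'' q n \<theta> + 2 * q * cos \<theta> * gegenbauer' q n \<theta>
     + real n * (real n + 2 * q) * sin \<theta> * gegenbauer q n \<theta> = 0"
proof -
  define B where "B k = (-q gchoose k)" for k
  have rec: "(real k + 1) * B (Suc k) = - (q + real k) * B k" for k
    unfolding B_def by (rule gbinomial_neg_Suc)
  \<comment> \<open>By the addition theorems each summand becomes a difference of two sine terms, and the
    recurrence for the binomial coefficients makes the sum telescope.\<close>
  define s where "s k = sin ((2 * real k - real n - 1) * \<theta>)" for k
  define F where "F k = (if k \<le> n then 2 * real (n - k) * (real k + q) * B k * B (n - k) * s (Suc k) else 0)" for k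
  define G where "G k = (if k \<le> n then 2 * real k * (real (n - k) + q) * B k * B (n - k) * s k else 0)" for k
  have summand: "sin \<theta> * (B k * B (n - k) * (- (real k - real (n - k))\<^sup>2 * cos ((real k - real (n - k)) * \<theta>)))
      + 2 * q * cos \<theta> * (B k * B (n - k) * (- (real k - real (n - k)) * sin ((real k - real (n - k)) * \<theta>)))
      + real n * (real n + 2 * q) * sin \<theta> * (B k * B (n - k) * cos ((real k - real (n - k)) * \<theta>))
      = F k - G k" if "k \<le> n" for k
  proof -
    define l where "l = real (n - k)"
    define K where "K = real k"
    have n: "real n = K + l" using that by (simp add: l_def K_def)
    define m where "m = K - l"
    have s1: "s (Suc k) = sin (m * \<theta> + \<theta>)" and s2: "s k = sin (m * \<theta> - \<theta>)"
      by (simp_all add: s_def n m_def K_def[symmetric] algebra_simps)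
    have "F k - G k = B k * B (n - k) * (2 * l * (K + q) * sin (m * \<theta> + \<theta>) - 2 * K * (l + q) * sin (m * \<theta> - \<theta>))"
      using that by (simp add: F_def G_def s1 s2 l_def[symmetric] K_def[symmetric] algebra_simps)
    also have "2 * l * (K + q) * sin (m * \<theta> + \<theta>) - 2 * K * (l + q) * sin (m * \<theta> - \<theta>) =
       sin \<theta> * (- m\<^sup>2 * cos (m * \<theta>)) + 2 * q * cos \<theta> * (- m * sin (m * \<theta>)) +
       real n * (real n + 2 * q) * sin \<theta> * cos (m * \<theta>)"
      unfolding n sin_add sin_diff m_def by (simp add: algebra_simps power2_eq_square)
    finally show ?thesis
      unfolding l_def[symmetric] K_def[symmetric] m_def[symmetric] by (simp add: algebra_simps)
  qed
  have shift: "F k = G (Suc k)" for k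
  proof (cases "k < n")
    case True
    define l where "l = n - Suc k"
    have l: "n - k = Suc l" "n - Suc k = l" using True by (auto simp: l_def)
    have "F k = 2 * s (Suc k) * (real l + 1) * B (Suc l) * ((q + real k) * B k)"
      using True by (simp add: F_def l algebra_simps)
    also have "\<dots> = 2 * s (Suc k) * ((real l + 1) * B (Suc l)) * (- (real k + 1) * B (Suc k))"
    proof -
      have "(q + real k) * B k = - (real k + 1) * B (Suc k)" using rec[of k] by (simp add: algebra_simps)
      then show ?thesis by (simp only: mult.assoc)
    qed
    also have "\<dots> = 2 * s (Suc k) * (- (q + real l) * B l) * (- (real k + 1) * B (Suc k))"
      by (subst rec) simp
    also have "\<dots> = G (Suc k)" using True by (simp add: G_def l algebra_simps)
    finally show ?thesis .
  qed (auto simp: F_def G_def)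
  have "(\<Sum>k\<le>n. F k - G k) = (\<Sum>k\<le>n. G (Suc k) - G k)" by (simp add: shift)
  also have "\<dots> = G (Suc n) - G 0"
    using sum_lessThan_telescope[of G "Suc n"] by (simp only: lessThan_Suc_atMost)
  also have "\<dots> = 0" by (simp add: G_def)
  finally show ?thesis
    unfolding gegenbauer_def gegenbauer'_def gegenbauer''_def B_def[symmetric] sum_distrib_left
       sum.distrib[symmetric] using summand by simp
qed

text \<open>
  A trigonometric polynomial is a polynomial in a point of the unit circle, and has finitely many zeros
  there.
\<close>

lemma gegenbauer_not_zero_on_interval:
  assumes "q > 0" "0 \<le> a" "a < b" "b \<le> pi"
  shows "\<exists>\<theta>\<in>{a<..<b}. gegenbauer q n \<theta> \<noteq> 0"
proof (rule ccontr)
  assume "\<not> ?thesis"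
  then have zero: "gegenbauer q n \<theta> = 0" if "a < \<theta>" "\<theta> < b" for \<theta> using that by auto
  define B where "B k = (-q gchoose k)" for k
  have B0: "B k \<noteq> 0" for k
    using assms unfolding B_def by (simp add: gbinomial_prod_rev add_pos_nonneg)
  \<comment> \<open>Up to a unimodular factor, the function is the value of P at exp(2 i \<theta>).\<close>
  define P where "P = (\<Sum>k\<le>n. monom (complex_of_real (B k * B (n - k))) k)"
  have "coeff P n = of_real (B n * B 0)"
    by (simp add: P_def coeff_sum if_distrib cong: if_cong)
  then have P: "P \<noteq> 0" using B0 by auto
  have root: "poly P (cis (2 * \<theta>)) = 0" if "a < \<theta>" "\<theta> < b" for \<theta>
  proof -
    define Q where "Q = (\<Sum>k\<le>n. of_real (B k * B (n - k)) * cis ((real k - real (n - k)) * \<theta>))"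
    have "cnj Q = (\<Sum>k\<le>n. of_real (B k * B (n - k)) * cis ((real (n - k) - real k) * \<theta>))"
      by (simp add: Q_def cis_cnj algebra_simps)
    also have "\<dots> = Q" unfolding Q_def
      by (rule sum.reindex_bij_witness[where i = "\<lambda>k. n - k" and j = "\<lambda>k. n - k"]) auto
    finally have "Im Q = 0" by (metis complex_cnj_cancel_iff complex_is_Real_iff Reals_cnj_iff)
    moreover have "Re Q = gegenbauer q n \<theta>"
      by (simp add: Q_def gegenbauer_def B_def)
    ultimately have "Q = 0" using zero that by (simp add: complex_eq_iff)
    moreover have "poly P (cis (2 * \<theta>)) = cis (n * \<theta>) * Q"
      unfolding P_def Q_def poly_sum sum_distrib_left
    proof (intro sum.cong refl)
      fix k assume "k \<in> {..n}"
      then have "2 * \<theta> * real k = real n * \<theta> + (real k - real (n - k)) * \<theta>" by (simp add: algebra_simps)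
      then show "poly (monom (of_real (B k * B (n - k))) k) (cis (2 * \<theta>)) =
           cis (real n * \<theta>) * (of_real (B k * B (n - k)) * cis ((real k - real (n - k)) * \<theta>))"
        by (simp add: poly_monom Complex.DeMoivre cis_mult mult_ac)
    qed
    ultimately show ?thesis by simp
  qed
  have inj: "inj_on (\<lambda>\<theta>. cis (2 * \<theta>)) {a<..<b}"
  proof (rule inj_onI)
    fix x y assume xy: "x \<in> {a<..<b}" "y \<in> {a<..<b}" "cis (2 * x) = cis (2 * y)"
    show "x = y"
    proof (rule ccontr)
      assume "x \<noteq> y"
      have "sin (x - y) \<noteq> 0"
        using \<open>x \<noteq> y\<close> xy assms sin_gt_zero[of "x - y"] sin_gt_zero[of "y - x"] sin_minus[of "y - x"]
        by (cases "x < y") auto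
      moreover have "cis (2 * x) - cis (2 * y) = cis (x + y) * (cis (x - y) - cis (-(x - y)))"
        by (simp add: right_diff_distrib cis_mult)
      then have "cis (x - y) - cis (-(x - y)) = 0" using xy by simp
      then have "Im (cis (x - y) - cis (- (x - y))) = 0" by simp
      then have "sin (x - y) = 0" by (simp only: minus_complex.sel cis.sel sin_minus)
      ultimately show False by simp
    qed
  qed
  have "infinite ((\<lambda>\<theta>. cis (2 * \<theta>)) ` {a<..<b})"
    using inj assms by (simp add: finite_image_iff infinite_Ioo)
  moreover have "(\<lambda>\<theta>. cis (2 * \<theta>)) ` {a<..<b} \<subseteq> {x. poly P x = 0}" using root by auto
  ultimately show False using poly_roots_finite[OF P] finite_subset by blast
qed

text \<open>
  Sturm comparison for (sin^(2q) g')' + \<nu> sin^(2q) g = 0 with a solution h for the smaller parameter \<mu>,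
  on an interval between consecutive zeros of h. At the ends 0 and pi of the range the weight vanishes and
  no condition on h is needed.
\<close>

lemma sturm_comparison_sign:
  fixes g h :: "real \<Rightarrow> real"
  assumes q: "q > 0" and \<mu>\<nu>: "\<mu> < \<nu>" and ab: "0 \<le> a" "a < b" "b \<le> pi"
    and h: "\<And>\<theta>. (h has_real_derivative h' \<theta>) (at \<theta>)" "\<And>\<theta>. (h' has_real_derivative h2 \<theta>) (at \<theta>)"
      "\<And>\<theta>. sin \<theta> * h2 \<theta> + 2 * q * cos \<theta> * h' \<theta> + \<mu> * sin \<theta> * h \<theta> = 0"
    and g: "\<And>\<theta>. (g has_real_derivative g' \<theta>) (at \<theta>)" "\<And>\<theta>. (g' has_real_derivative g2 \<theta>) (at \<theta>)"
      "\<And>\<theta>. sin \<theta> * g2 \<theta> + 2 * q * cos \<theta> * g' \<theta> + \<nu> * sin \<theta> * g \<theta> = 0"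
    and h_pos: "\<And>\<theta>. a < \<theta> \<Longrightarrow> \<theta> < b \<Longrightarrow> h \<theta> > 0"
    and h_a: "a = 0 \<or> h a = 0 \<and> h' a \<ge> 0" and h_b: "b = pi \<or> h b = 0 \<and> h' b \<le> 0"
    and c: "a < c" "c < b" "g c \<noteq> 0"
  shows "\<exists>\<theta>\<in>{a<..<b}. g \<theta> > 0"
proof (rule ccontr)
  assume "\<not> ?thesis"
  then have g_le: "g \<theta> \<le> 0" if "a < \<theta>" "\<theta> < b" for \<theta> using that by (auto simp: not_less)
  have cont_g: "continuous_on S g" for S using g(1) by (meson DERIV_continuous_on has_field_derivative_at_within)
  have closure: "closure {a<..<b} = {a..b}" using ab by simp
  have g_le': "g \<theta> \<le> 0" if "\<theta> \<in> {a..b}" for \<theta>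
    using continuous_le_on_closure[of "{a<..<b}" g \<theta> 0] cont_g that g_le closure by auto
  \<comment> \<open>If g is nowhere positive, the weighted Wronskian W cannot increase; but the conditions at the ends
    make it nonpositive on the left and nonnegative on the right, so W is constant and g h vanishes.\<close>
  define W where "W \<theta> = sin \<theta> powr (2 * q) * (h' \<theta> * g \<theta> - h \<theta> * g' \<theta>)" for \<theta>
  have cont_W: "continuous_on {a..b} W"
  proof -
    have cont: "continuous_on {a..b} h" "continuous_on {a..b} h'" "continuous_on {a..b} g'"
      using h g by (meson DERIV_continuous_on has_field_derivative_at_within)+
    have "continuous_on {a..b} (\<lambda>\<theta>. sin \<theta> powr (2 * q))"
      using ab q by (intro continuous_on_powr' continuous_intros) (auto intro: sin_ge_zero)
    then show ?thesis unfolding W_def by (intro continuous_on_mult continuous_on_diff cont cont_g)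
  qed
  have W': "(W has_real_derivative sin \<theta> powr (2 * q) * ((\<nu> - \<mu>) * h \<theta> * g \<theta>)) (at \<theta>)"
    if "a < \<theta>" "\<theta> < b" for \<theta>
  proof -
    have s: "sin \<theta> > 0" using that ab by (intro sin_gt_zero) auto
    have "((\<lambda>\<theta>. sin \<theta> powr (2 * q)) has_real_derivative (2 * q) * sin \<theta> powr (2 * q - 1) * cos \<theta>) (at \<theta>)"
      using DERIV_fun_powr[OF DERIV_sin s, of "2 * q"] by simp
    then have W: "(W has_real_derivative
       (2 * q) * sin \<theta> powr (2 * q - 1) * cos \<theta> * (h' \<theta> * g \<theta> - h \<theta> * g' \<theta>) +
       ((h2 \<theta> * g \<theta> + g' \<theta> * h' \<theta>) - (h' \<theta> * g' \<theta> + g2 \<theta> * h \<theta>)) * sin \<theta> powr (2 * q)) (at \<theta>)"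
      unfolding W_def by (intro DERIV_mult DERIV_diff h g)
    have p: "sin \<theta> powr (2 * q) = sin \<theta> powr (2 * q - 1) * sin \<theta>"
      using s powr_add[of "sin \<theta>" "2 * q - 1" 1] by simp
    have "sin \<theta> * h2 \<theta> = - (2 * q * cos \<theta> * h' \<theta> + \<mu> * sin \<theta> * h \<theta>)"
      "sin \<theta> * g2 \<theta> = - (2 * q * cos \<theta> * g' \<theta> + \<nu> * sin \<theta> * g \<theta>)"
      using h(3)[of \<theta>] g(3)[of \<theta>] by linarith+
    then have "(2 * q) * cos \<theta> * (h' \<theta> * g \<theta> - h \<theta> * g' \<theta>) +
       ((h2 \<theta> * g \<theta> + g' \<theta> * h' \<theta>) - (h' \<theta> * g' \<theta> + g2 \<theta> * h \<theta>)) * sin \<theta> =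
        sin \<theta> * ((\<nu> - \<mu>) * h \<theta> * g \<theta>)"
      by algebra
    then have "(2 * q) * sin \<theta> powr (2 * q - 1) * cos \<theta> * (h' \<theta> * g \<theta> - h \<theta> * g' \<theta>) +
       ((h2 \<theta> * g \<theta> + g' \<theta> * h' \<theta>) - (h' \<theta> * g' \<theta> + g2 \<theta> * h \<theta>)) * sin \<theta> powr (2 * q) =
        sin \<theta> powr (2 * q) * ((\<nu> - \<mu>) * h \<theta> * g \<theta>)"
      unfolding p by algebra
    with W show ?thesis by (rule DERIV_cong)
  qed
  have W'_le: "sin \<theta> powr (2 * q) * ((\<nu> - \<mu>) * h \<theta> * g \<theta>) \<le> 0" if "a < \<theta>" "\<theta> < b" for \<theta>
    using h_pos[OF that] g_le[OF that] \<mu>\<nu> by (intro mult_nonneg_nonpos) auto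
  have mono: "W y \<le> W x" if "a \<le> x" "x \<le> y" "y \<le> b" for x y
  proof (cases "x = y")
    case False
    have "- W x \<le> - W y"
    proof (rule DERIV_nonneg_imp_increasing_open[of x y "\<lambda>\<theta>. - W \<theta>"])
      show "x \<le> y" by fact
      show "\<exists>D. ((\<lambda>\<theta>. - W \<theta>) has_real_derivative D) (at \<theta>) \<and> 0 \<le> D" if "x < \<theta>" "\<theta> < y" for \<theta>
        using DERIV_minus[OF W'[of \<theta>]] W'_le[of \<theta>] that \<open>a \<le> x\<close> \<open>y \<le> b\<close> by fastforce
      show "continuous_on {x..y} (\<lambda>\<theta>. - W \<theta>)"
        using that by (intro continuous_intros continuous_on_subset[OF cont_W]) auto
    qed
    then show ?thesis by simp
  qed simp
  have "W a \<le> 0"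
    using h_a
  proof
    assume "h a = 0 \<and> h' a \<ge> 0"
    then show ?thesis using g_le'[of a] ab unfolding W_def
      by (intro mult_nonneg_nonpos) (auto intro: mult_nonneg_nonpos)
  qed (simp add: W_def)
  moreover have "W b \<ge> 0"
    using h_b
  proof
    assume "h b = 0 \<and> h' b \<le> 0"
    then show ?thesis using g_le'[of b] ab unfolding W_def
      by (intro mult_nonneg_nonneg) (auto intro: mult_nonpos_nonpos)
  qed (simp add: W_def)
  ultimately have W0: "W x = 0" if "a \<le> x" "x \<le> b" for x
    using mono[of a x] mono[of x b] that ab by auto
  have "(W has_real_derivative 0) (at c)"
  proof (rule DERIV_cong_ev[THEN iffD1, OF refl _ refl, OF _ DERIV_const])
    have "eventually (\<lambda>x. x \<in> {a<..<b}) (nhds c)" using c by (intro eventually_nhds_in_open) auto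
    then show "eventually (\<lambda>x. 0 = W x) (nhds c)" by eventually_elim (simp add: W0)
  qed
  then have "sin c powr (2 * q) * ((\<nu> - \<mu>) * h c * g c) = 0"
    using W'[OF c(1,2)] DERIV_unique by blast
  moreover have "sin c > 0" using c ab by (intro sin_gt_zero) auto
  ultimately show False using h_pos[OF c(1,2)] c(3) \<mu>\<nu> by auto
qed

lemma gegenbauer_2: "gegenbauer q 2 \<theta> = 2 * q * (q + 1) * (cos \<theta>)\<^sup>2 - q"
proof -
  have b: "(-q gchoose Suc 0) = -q" "(-q gchoose 2) = q * (q + 1) / 2" "(-q gchoose Suc (Suc 0)) = q * (q + 1) / 2"
    by (simp_all add: gbinomial_prod_rev numeral_2_eq_2 algebra_simps)
  show ?thesis
    using cos_double_cos[of \<theta>]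
    by (simp add: gegenbauer_def numeral_2_eq_2 b mult.commute[of \<theta>]) (simp add: algebra_simps power2_eq_square)
qed

lemma gegenbauer'_2: "gegenbauer' q 2 \<theta> = - 4 * q * (q + 1) * cos \<theta> * sin \<theta>"
proof -
  have "(gegenbauer q 2 has_real_derivative - 4 * q * (q + 1) * cos \<theta> * sin \<theta>) (at \<theta>)"
    unfolding gegenbauer_2[abs_def] by (auto intro!: derivative_eq_intros)
  then show ?thesis using has_real_derivative_gegenbauer DERIV_unique by blast
qed

text \<open>
  The zeros of the function of degree 2 divide the range into three intervals, and by Sturm comparison the
  function of degree n takes both signs in each of them.
\<close>

lemma gegenbauer_alternating_signs:
  assumes q: "q > 0" and n: "n \<ge> 3" and \<epsilon>: "\<epsilon> \<noteq> 0"
  obtains \<theta>1 \<theta>2 \<theta>3 where "0 < \<theta>1" "\<theta>1 < \<theta>2" "\<theta>2 < \<theta>3" "\<theta>3 < pi"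
    "\<epsilon> * gegenbauer q n \<theta>1 > 0" "\<epsilon> * gegenbauer q n \<theta>2 < 0" "\<epsilon> * gegenbauer q n \<theta>3 > 0"
proof -
  \<comment> \<open>The zeros of the function of degree 2 are \<alpha> and pi - \<alpha> with cos \<alpha> = c.\<close>
  define c where "c = 1 / sqrt (2 * (q + 1))"
  have c: "0 < c" "c < 1" "c\<^sup>2 = 1 / (2 * (q + 1))"
    using q by (auto simp: c_def power_divide)
  define \<alpha> where "\<alpha> = arccos c"
  have cos\<alpha>: "cos \<alpha> = c" using c by (simp add: \<alpha>_def)
  have \<alpha>: "0 < \<alpha>" "\<alpha> < pi / 2"
    using c arccos_lt_bounded[of c] arccos_less_arccos[of 0 c] by (auto simp: \<alpha>_def)
  define G where "G = gegenbauer q 2"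
  have G: "G \<theta> = 2 * q * (q + 1) * ((cos \<theta>)\<^sup>2 - c\<^sup>2)" for \<theta>
    using q unfolding G_def gegenbauer_2 c(3) by (simp add: field_simps)
  have key: "\<exists>\<theta>\<in>{a<..<b}. s * gegenbauer q n \<theta> > 0"
    if ab: "0 \<le> a" "a < b" "b \<le> pi" and s: "s \<noteq> 0"
      and pos: "\<And>\<theta>. a < \<theta> \<Longrightarrow> \<theta> < b \<Longrightarrow> t * G \<theta> > 0"
      and ha: "a = 0 \<or> G a = 0 \<and> t * gegenbauer' q 2 a \<ge> 0"
      and hb: "b = pi \<or> G b = 0 \<and> t * gegenbauer' q 2 b \<le> 0" for a b s t :: real
  proof -
    obtain x where x: "x \<in> {a<..<b}" "gegenbauer q n x \<noteq> 0"
      using gegenbauer_not_zero_on_interval[OF q ab] by blast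
    have scaled_ode: "sin \<theta> * (r * gegenbauer'' q m \<theta>) + 2 * q * cos \<theta> * (r * gegenbauer' q m \<theta>) +
            (real m * (real m + 2 * q)) * sin \<theta> * (r * gegenbauer q m \<theta>) = 0" for m \<theta> r
    proof -
      have "sin \<theta> * (r * gegenbauer'' q m \<theta>) + 2 * q * cos \<theta> * (r * gegenbauer' q m \<theta>) +
            (real m * (real m + 2 * q)) * sin \<theta> * (r * gegenbauer q m \<theta>) =
           r * (sin \<theta> * gegenbauer'' q m \<theta> + 2 * q * cos \<theta> * gegenbauer' q m \<theta>
     + real m * (real m + 2 * q) * sin \<theta> * gegenbauer q m \<theta>)" by (simp add: algebra_simps)
      then show ?thesis by (simp only: gegenbauer_ode)
    qed
    have "real 2 * (real 2 + 2 * q) < real n * (real n + 2 * q)"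
      using n q by (intro mult_strict_mono) auto
    then show ?thesis
    proof (rule sturm_comparison_sign[OF q _ ab, where h = "\<lambda>\<theta>. t * G \<theta>" and c = x])
      show "((\<lambda>\<theta>. t * G \<theta>) has_real_derivative t * gegenbauer' q 2 \<theta>) (at \<theta>)" for \<theta>
        unfolding G_def by (intro DERIV_cmult has_real_derivative_gegenbauer)
      show "((\<lambda>\<theta>. t * gegenbauer' q 2 \<theta>) has_real_derivative t * gegenbauer'' q 2 \<theta>) (at \<theta>)" for \<theta>
        by (intro DERIV_cmult has_real_derivative_gegenbauer')
      show "((\<lambda>\<theta>. s * gegenbauer q n \<theta>) has_real_derivative s * gegenbauer' q n \<theta>) (at \<theta>)" for \<theta>
        by (intro DERIV_cmult has_real_derivative_gegenbauer)
      show "((\<lambda>\<theta>. s * gegenbauer' q n \<theta>) has_real_derivative s * gegenbauer'' q n \<theta>) (at \<theta>)" for \<theta>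
        by (intro DERIV_cmult has_real_derivative_gegenbauer')
      show "sin \<theta> * (t * gegenbauer'' q 2 \<theta>) + 2 * q * cos \<theta> * (t * gegenbauer' q 2 \<theta>) +
          real 2 * (real 2 + 2 * q) * sin \<theta> * (t * G \<theta>) = 0" for \<theta>
        unfolding G_def by (rule scaled_ode)
      show "sin \<theta> * (s * gegenbauer'' q n \<theta>) + 2 * q * cos \<theta> * (s * gegenbauer' q n \<theta>) +
          real n * (real n + 2 * q) * sin \<theta> * (s * gegenbauer q n \<theta>) = 0" for \<theta>
        by (rule scaled_ode)
    qed (use pos ha hb x s in auto)
  qed
  have cos_gt: "c < cos \<theta>" if "0 \<le> \<theta>" "\<theta> < \<alpha>" for \<theta>
    using cos_monotone_0_pi[of \<theta> \<alpha>] that \<alpha> cos\<alpha> by auto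
  have cos_lt: "cos \<theta> < c" if "\<alpha> < \<theta>" "\<theta> \<le> pi" for \<theta>
    using cos_monotone_0_pi[of \<alpha> \<theta>] that \<alpha> cos\<alpha> by auto
  have G_pos: "G \<theta> > 0" if "c < \<bar>cos \<theta>\<bar>" for \<theta>
  proof -
    have "c\<^sup>2 < \<bar>cos \<theta>\<bar>\<^sup>2" using that c by (intro power_strict_mono) auto
    then show ?thesis unfolding G using q by (intro mult_pos_pos) auto
  qed
  have G_neg: "G \<theta> < 0" if "\<bar>cos \<theta>\<bar> < c" for \<theta>
  proof -
    have "\<bar>cos \<theta>\<bar>\<^sup>2 < c\<^sup>2" using that c by (intro power_strict_mono) auto
    then show ?thesis unfolding G using q by (intro mult_pos_neg) auto
  qed
  have G\<alpha>: "G \<alpha> = 0" "G (pi - \<alpha>) = 0" by (simp_all add: G cos\<alpha>)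
  have sin\<alpha>: "sin \<alpha> > 0" using \<alpha> by (intro sin_gt_zero) auto
  have pos: "4 * q * (q + 1) * c * sin \<alpha> > 0" using q c sin\<alpha> by (intro mult_pos_pos) auto
  have g'\<alpha>: "gegenbauer' q 2 \<alpha> \<le> 0" "gegenbauer' q 2 (pi - \<alpha>) \<ge> 0"
    using pos by (simp_all add: gegenbauer'_2 cos\<alpha>)
  have "\<exists>\<theta>\<in>{0<..<\<alpha>}. \<epsilon> * gegenbauer q n \<theta> > 0"
  proof (rule key[where t = 1])
    show "1 * G \<theta> > 0" if "0 < \<theta>" "\<theta> < \<alpha>" for \<theta>
      using G_pos[of \<theta>] cos_gt[of \<theta>] that abs_ge_self[of "cos \<theta>"] by linarith
  qed (use \<alpha> \<epsilon> G\<alpha> g'\<alpha> in auto)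
  then obtain \<theta>1 where 1: "0 < \<theta>1" "\<theta>1 < \<alpha>" "\<epsilon> * gegenbauer q n \<theta>1 > 0" by auto
  have "\<exists>\<theta>\<in>{\<alpha><..<pi - \<alpha>}. - \<epsilon> * gegenbauer q n \<theta> > 0"
  proof (rule key[where t = "-1"])
    show "- 1 * G \<theta> > 0" if "\<alpha> < \<theta>" "\<theta> < pi - \<alpha>" for \<theta>
    proof -
      have "cos \<theta> < c" using that \<alpha> by (intro cos_lt) auto
      moreover have "cos (pi - \<theta>) < c" using that \<alpha> by (intro cos_lt) auto
      ultimately have "\<bar>cos \<theta>\<bar> < c" by simp
      then show ?thesis using G_neg[of \<theta>] by simp
    qed
  qed (use \<alpha> \<epsilon> G\<alpha> g'\<alpha> in auto)
  then obtain \<theta>2 where 2: "\<alpha> < \<theta>2" "\<theta>2 < pi - \<alpha>" "- \<epsilon> * gegenbauer q n \<theta>2 > 0" by auto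
  have "\<exists>\<theta>\<in>{pi - \<alpha><..<pi}. \<epsilon> * gegenbauer q n \<theta> > 0"
  proof (rule key[where t = 1])
    show "1 * G \<theta> > 0" if "pi - \<alpha> < \<theta>" "\<theta> < pi" for \<theta>
    proof -
      have "c < cos (pi - \<theta>)" using that by (intro cos_gt) auto
      then have "c < \<bar>cos \<theta>\<bar>" by simp
      then show ?thesis using G_pos[of \<theta>] by simp
    qed
  qed (use \<alpha> \<epsilon> G\<alpha> g'\<alpha> in auto)
  then obtain \<theta>3 where 3: "pi - \<alpha> < \<theta>3" "\<theta>3 < pi" "\<epsilon> * gegenbauer q n \<theta>3 > 0" by auto
  show thesis using 1 2 3 by (intro that[of \<theta>1 \<theta>2 \<theta>3]) auto
qed

section \<open>Expansion of the potential along rays\<close>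

text \<open>
  The mixed moments of the charges as seen from z. The coefficients of h^k cnj(h)^l in the expansion of
  U(z + h) are multiples of them, apart from the uniform field.
\<close>

definition moment :: "real \<Rightarrow> real set \<Rightarrow> (real \<Rightarrow> real) \<Rightarrow> complex \<Rightarrow> nat \<Rightarrow> nat \<Rightarrow> complex" where
  "moment p X d z k l = (\<Sum>x\<in>X. of_real (d x * cmod (z - of_real x) powr (-p)) *
      (1 / (z - of_real x)) ^ k * cnj (1 / (z - of_real x)) ^ l)"

text \<open>
  The derivatives of U in Re z and in the square of Im z vanish. Off the axis this means that the gradient is
  zero. On the axis the gradient in the second direction vanishes by symmetry; the condition is that the second
  derivatives vanish there too.
\<close>

definition critical :: "real \<Rightarrow> real \<Rightarrow> real set \<Rightarrow> (real \<Rightarrow> real) \<Rightarrow> complex \<Rightarrow> bool" where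
  "critical p \<kappa> X d z \<longleftrightarrow> moment p X d z 1 0 = of_real (\<kappa> / p) \<and> moment p X d z 1 1 = 0"

text \<open>
  The coefficient of t^n in the expansion of the charge part of U(z + t u).
\<close>

definition ray_coeff :: "real \<Rightarrow> real set \<Rightarrow> (real \<Rightarrow> real) \<Rightarrow> complex \<Rightarrow> complex \<Rightarrow> nat \<Rightarrow> real" where
  "ray_coeff p X d z u n = Re (\<Sum>k\<le>n. of_real ((-(p/2) gchoose k) * (-(p/2) gchoose (n - k))) *
      moment p X d z k (n - k) * u ^ k * cnj u ^ (n - k))"

text \<open>
  The series is the Cauchy product of the binomial series of (1 + t)^(-q) and its conjugate.
\<close>

lemma cmod_powr_series:
  fixes t :: complex and q :: real
  assumes t: "norm t < 1"
  shows "(\<lambda>n. \<Sum>k\<le>n. of_real ((-q gchoose k) * (-q gchoose (n - k))) * t ^ k * cnj t ^ (n - k))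
           sums of_real (cmod (1 + t) powr (-2 * q))"
proof -
  define a where "a k = complex_of_real (-q gchoose k)" for k
  have S: "(\<lambda>k. a k * t ^ k) sums (1 + t) powr (of_real (-q))" if "norm t < 1" for t
    using gen_binomial_complex[OF that, of "of_real (-q)"] by (simp add: a_def of_real_gbinomial)
  obtain r where r: "norm t < r" "r < 1" using dense[OF t] by blast
  have "summable (\<lambda>k. a k * of_real r ^ k)"
    using S[of "of_real r"] r norm_ge_zero[of t] by (auto simp: sums_iff)
  then have abs: "summable (\<lambda>k. norm (a k * t ^ k))"
    by (rule powser_insidea) (use r norm_ge_zero[of t] in auto)
  have cnj_term: "a k * cnj t ^ k = cnj (a k * t ^ k)" for k by (simp add: a_def)
  have abs': "summable (\<lambda>k. norm (a k * cnj t ^ k))"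
    unfolding cnj_term complex_mod_cnj by (rule abs)
  define w where "w = (1 + t) powr (of_real (-q))"
  have sums_t: "(\<lambda>k. a k * t ^ k) sums w" using S[OF t] by (simp add: w_def)
  then have "(\<lambda>k. cnj (a k * t ^ k)) sums cnj w" by (simp only: sums_cnj)
  then have sums_t': "(\<lambda>k. a k * cnj t ^ k) sums cnj w" unfolding cnj_term .
  have "(\<lambda>n. \<Sum>k\<le>n. (a k * t ^ k) * (a (n - k) * cnj t ^ (n - k))) sums (w * cnj w)"
    using Cauchy_product_sums[OF abs abs'] sums_t sums_t' by (simp only: sums_unique[symmetric])
  moreover have "w * cnj w = of_real (cmod (1 + t) powr (-2 * q))"
  proof -
    have ne: "1 + t \<noteq> 0"
    proof
      assume "1 + t = 0"
      then have "t = -1" by (simp add: add_eq_0_iff)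
      then show False using t by simp
    qed
    have "cmod w = exp (-q * ln (cmod (1 + t)))"
      using ne by (simp add: w_def powr_def)
    also have "\<dots> = cmod (1 + t) powr (-q)" using ne by (simp add: powr_def)
    finally have "(cmod w)\<^sup>2 = cmod (1 + t) powr (-2 * q)"
      by (simp add: power2_eq_square flip: powr_add)
    moreover have "w * cnj w = of_real ((cmod w)\<^sup>2)" by (simp only: complex_norm_square)
    ultimately show ?thesis by (simp only:)
  qed
  ultimately show ?thesis by (simp add: a_def mult_ac)
qed

lemma potential_ray_sums:
  fixes u :: complex and t :: real
  assumes X: "finite X" and z: "z \<notin> of_real ` X"
    and small: "\<And>x. x \<in> X \<Longrightarrow> \<bar>t\<bar> * cmod u < cmod (z - of_real x)"
  shows "(\<lambda>n. ray_coeff p X d z u n * t ^ n) sums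
            (\<Sum>x\<in>X. d x * cmod (z + of_real t * u - of_real x) powr (-p))"
proof -
  define B where "B k = (-(p/2) gchoose k)" for k
  define \<tau> where "\<tau> x = 1 / (z - of_real x)" for x
  define w where "w x = d x * cmod (z - of_real x) powr (-p)" for x
  define s where "s x = of_real t * u * \<tau> x" for x
  have "(\<lambda>n. of_real (w x) * (\<Sum>k\<le>n. of_real (B k * B (n - k)) * s x ^ k * cnj (s x) ^ (n - k))) sums
      of_real (d x * cmod (z + of_real t * u - of_real x) powr (-p))" if x: "x \<in> X" for x
  proof -
    have ne: "z - of_real x \<noteq> 0" using z x by auto
    have "norm (s x) < 1" using small[OF x] ne by (simp add: s_def \<tau>_def norm_mult norm_divide)
    from sums_mult[OF cmod_powr_series[OF this, of "p/2"], of "of_real (w x)"]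
    have "(\<lambda>n. of_real (w x) * (\<Sum>k\<le>n. of_real (B k * B (n - k)) * s x ^ k * cnj (s x) ^ (n - k))) sums
      (of_real (w x) * of_real (cmod (1 + s x) powr (-p)))" by (simp add: B_def)
    moreover have "z + of_real t * u - of_real x = (z - of_real x) * (1 + s x)"
      using ne by (simp add: s_def \<tau>_def field_simps)
    then have "cmod (z + of_real t * u - of_real x) = cmod (z - of_real x) * cmod (1 + s x)"
      by (simp add: norm_mult)
    then have "cmod (z + of_real t * u - of_real x) powr (-p) =
       cmod (z - of_real x) powr (-p) * cmod (1 + s x) powr (-p)" by (simp add: powr_mult)
    ultimately show ?thesis by (simp add: w_def mult_ac)
  qed
  from sums_sum[OF this]
  have "(\<lambda>n. \<Sum>x\<in>X. of_real (w x) * (\<Sum>k\<le>n. of_real (B k * B (n - k)) * s x ^ k * cnj (s x) ^ (n - k))) sums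
      (\<Sum>x\<in>X. of_real (d x * cmod (z + of_real t * u - of_real x) powr (-p)))" .
  moreover have "(\<Sum>x\<in>X. of_real (w x) * (\<Sum>k\<le>n. of_real (B k * B (n - k)) * s x ^ k * cnj (s x) ^ (n - k))) =
      of_real (t ^ n) * (\<Sum>k\<le>n. of_real (B k * B (n - k)) * moment p X d z k (n - k) * u ^ k * cnj u ^ (n - k))" for n
  proof -
    have "(\<Sum>x\<in>X. of_real (w x) * (\<Sum>k\<le>n. of_real (B k * B (n - k)) * s x ^ k * cnj (s x) ^ (n - k))) =
      (\<Sum>k\<le>n. \<Sum>x\<in>X. of_real (w x) * (of_real (B k * B (n - k)) * s x ^ k * cnj (s x) ^ (n - k)))"
      unfolding sum_distrib_left by (rule sum.swap)
    also have "\<dots> = (\<Sum>k\<le>n. of_real (t ^ n) * (of_real (B k * B (n - k)) * moment p X d z k (n - k) * u ^ k * cnj u ^ (n - k)))"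
    proof (intro sum.cong refl)
      fix k assume "k \<in> {..n}"
      then have tn: "complex_of_real (t ^ n) = of_real t ^ k * of_real t ^ (n - k)"
        by (simp flip: power_add)
      show "(\<Sum>x\<in>X. of_real (w x) * (of_real (B k * B (n - k)) * s x ^ k * cnj (s x) ^ (n - k))) =
         of_real (t ^ n) * (of_real (B k * B (n - k)) * moment p X d z k (n - k) * u ^ k * cnj u ^ (n - k))"
        unfolding moment_def tn sum_distrib_left sum_distrib_right w_def[symmetric] \<tau>_def[symmetric] s_def
        by (intro sum.cong refl) (simp add: power_mult_distrib mult_ac)
    qed
    finally show ?thesis by (simp add: sum_distrib_left)
  qed
  ultimately have "(\<lambda>n. of_real (t ^ n) * (\<Sum>k\<le>n. of_real (B k * B (n - k)) * moment p X d z k (n - k) * u ^ k * cnj u ^ (n - k))) sums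
      (\<Sum>x\<in>X. of_real (d x * cmod (z + of_real t * u - of_real x) powr (-p)))" by simp
  from sums_Re[OF this] show ?thesis
    by (simp add: ray_coeff_def B_def mult.commute[of _ "t ^ _"])
qed

text \<open>
  At a critical point the constant and the linear term of the expansion cancel against U(z) and the
  uniform field, so the first nonzero coefficient from degree 2 on decides the sign. The factor \<sigma> allows
  ascent and descent to be treated together.
\<close>

lemma potential_ray_sign:
  assumes p: "p > 0" and X: "finite X" and z: "z \<in> charge_free X" and crit: "critical p \<kappa> X d z"
    and N: "N \<ge> 2" "\<And>n. 2 \<le> n \<Longrightarrow> n < N \<Longrightarrow> ray_coeff p X d z u n = 0"
    and sgn: "\<sigma> * ray_coeff p X d z u N > 0"
  shows "eventually (\<lambda>h. z + of_real h * u \<notin> of_real ` X \<and>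
     \<sigma> * (potential p \<kappa> X d (z + of_real h * u) - potential p \<kappa> X d z) > 0) (at_right 0)"
proof -
  have z': "z \<notin> of_real ` X" using z by (auto simp: charge_free_def)
  define r where "r = Min (insert 1 ((\<lambda>x. cmod (z - of_real x)) ` X)) / (1 + cmod u)"
  have "Min (insert 1 ((\<lambda>x. cmod (z - of_real x)) ` X)) > 0"
    using X z' by (subst Min_gr_iff) auto
  moreover have u1: "1 + cmod u > 0" by (simp add: add_pos_nonneg)
  ultimately have r: "r > 0" by (simp add: r_def)
  have small: "\<bar>t\<bar> * cmod u < cmod (z - of_real x)" if t: "\<bar>t\<bar> < r" and x: "x \<in> X" for t x
  proof -
    have "\<bar>t\<bar> * cmod u \<le> \<bar>t\<bar> * (1 + cmod u)" by (intro mult_left_mono) auto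
    also have "\<dots> < Min (insert 1 ((\<lambda>x. cmod (z - of_real x)) ` X))"
      using t u1 by (simp add: r_def pos_less_divide_eq)
    also have "\<dots> \<le> cmod (z - of_real x)" using X x by (intro Min_le) auto
    finally show ?thesis .
  qed
  define S where "S t = (\<Sum>x\<in>X. d x * cmod (z + of_real t * u - of_real x) powr (-p))" for t
  have sums: "(\<lambda>n. ray_coeff p X d z u n * t ^ n) sums S t" if "\<bar>t\<bar> < r" for t
    unfolding S_def by (rule potential_ray_sums[OF X z']) (use small that in auto)
  have S0: "S 0 = ray_coeff p X d z u 0"
    using sums[of 0] r by (simp add: sums_iff)
  have c1: "ray_coeff p X d z u 1 = - \<kappa> * Re u"
  proof -
    have m10: "moment p X d z (Suc 0) 0 = of_real (\<kappa> / p)" using crit by (simp add: critical_def)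
    have "moment p X d z 0 (Suc 0) = cnj (moment p X d z (Suc 0) 0)"
      by (simp add: moment_def)
    then have m01: "moment p X d z 0 (Suc 0) = of_real (\<kappa> / p)" by (simp add: m10)
    show ?thesis using p by (simp add: ray_coeff_def m10 m01)
  qed
  define D where "D t = potential p \<kappa> X d (z + of_real t * u) - potential p \<kappa> X d z" for t
  have D: "D t = S t - ray_coeff p X d z u 0 - ray_coeff p X d z u 1 * t" for t
    unfolding c1 S0[symmetric] by (simp add: D_def potential_def S_def algebra_simps)
  have "(\<lambda>i. ray_coeff p X d z u (i + N) * t ^ i) sums (D t / t ^ N)" if t: "t \<noteq> 0" "norm t < r" for t
  proof -
    have "(\<Sum>n<N. ray_coeff p X d z u n * t ^ n) = (\<Sum>n\<in>{0, 1}. ray_coeff p X d z u n * t ^ n)"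
    proof (rule sum.mono_neutral_right)
      show "\<forall>i\<in>{..<N} - {0, 1}. ray_coeff p X d z u i * t ^ i = 0"
      proof
        fix i assume "i \<in> {..<N} - {0, 1}"
        then have "2 \<le> i" "i < N" by auto
        then show "ray_coeff p X d z u i * t ^ i = 0" by (simp add: N(2))
      qed
    qed (use N in auto)
    then have "D t = S t - (\<Sum>n<N. ray_coeff p X d z u n * t ^ n)" by (simp add: D)
    then have "(\<lambda>i. ray_coeff p X d z u (i + N) * t ^ (i + N)) sums D t"
      using sums_split_initial_segment[OF sums[of t], of N] t by (simp only: real_norm_def)
    from sums_divide[OF this, of "t ^ N"] show ?thesis using t by (simp add: power_add)
  qed
  from powser_limit_0_strong[OF r this]
  have "((\<lambda>t. D t / t ^ N) \<longlongrightarrow> ray_coeff p X d z u N) (at 0)" by simp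
  then have "((\<lambda>t. D t / t ^ N) \<longlongrightarrow> ray_coeff p X d z u N) (at_right 0)"
    by (rule tendsto_mono[rotated]) (simp add: at_le)
  then have "((\<lambda>t. \<sigma> * (D t / t ^ N)) \<longlongrightarrow> \<sigma> * ray_coeff p X d z u N) (at_right 0)"
    by (intro tendsto_intros)
  then have "eventually (\<lambda>t. \<sigma> * (D t / t ^ N) > 0) (at_right 0)"
    using sgn by (rule order_tendstoD)
  moreover have "eventually (\<lambda>t::real. t \<in> {0<..<r}) (at_right 0)"
    using r by (intro eventually_at_right_real)
  ultimately show ?thesis
  proof eventually_elim
    case (elim t)
    have "\<sigma> * D t > 0"
    proof -
      have "\<sigma> * D t = (\<sigma> * (D t / t ^ N)) * t ^ N" using elim by simp
      also have "\<dots> > 0" by (rule mult_pos_pos) (use elim in simp_all)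
      finally show ?thesis .
    qed
    moreover have "z + of_real t * u \<noteq> of_real x" if "x \<in> X" for x
    proof
      assume "z + of_real t * u = of_real x"
      then have "z - of_real x = - (of_real t * u)" by (simp add: algebra_simps eq_neg_iff_add_eq_0)
      then have "cmod (z - of_real x) = \<bar>t\<bar> * cmod u" by (simp add: norm_mult)
      then show False using small[of t x] elim that by auto
    qed
    ultimately show ?case by (auto simp: D_def)
  qed
qed

lemma moment_cnj: "cnj (moment p X d z k l) = moment p X d z l k"
  by (simp add: moment_def mult_ac)

text \<open>
  A partial fraction decomposition. It replaces the differential equation in the proof that the leading
  part of the expansion at a critical point off the axis is harmonic.
\<close>

lemma moment_mixed:
  assumes z: "Im z \<noteq> 0"
  shows "moment p X d z (Suc k) (Suc l) = (moment p X d z (Suc k) l - moment p X d z k (Suc l)) / (cnj z - z)"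
proof -
  have ne: "cnj z - z \<noteq> 0" using z by (simp add: complex_eq_iff)
  define \<tau> where "\<tau> x = 1 / (z - of_real x)" for x
  have key: "\<tau> x * cnj (\<tau> x) = (\<tau> x - cnj (\<tau> x)) / (cnj z - z)" for x
  proof -
    have "z - of_real x \<noteq> 0" "cnj z - of_real x \<noteq> 0" using z by (auto simp: complex_eq_iff)
    then show ?thesis using ne by (simp add: \<tau>_def divide_simps)
  qed
  have "moment p X d z (Suc k) (Suc l) =
     (\<Sum>x\<in>X. of_real (d x * cmod (z - of_real x) powr (-p)) * \<tau> x ^ k * cnj (\<tau> x) ^ l * (\<tau> x * cnj (\<tau> x)))"
    unfolding moment_def \<tau>_def[symmetric] by (simp add: mult_ac)
  also have "\<dots> = (moment p X d z (Suc k) l - moment p X d z k (Suc l)) / (cnj z - z)"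
    unfolding key moment_def \<tau>_def[symmetric] sum_subtractf[symmetric] sum_divide_distrib
    by (intro sum.cong refl) (simp add: algebra_simps)
  finally show ?thesis .
qed

text \<open>
  The points 1 / (z - x) are distinct and nonzero, so their powers from the second on separate them
  (Vandermonde). The potential is therefore not flat at any point.
\<close>

lemma moment_nonzero:
  assumes X: "finite X" "X \<noteq> {}" and d: "\<And>x. x \<in> X \<Longrightarrow> d x \<noteq> 0" and z: "z \<notin> of_real ` X"
  shows "\<exists>n\<ge>2. moment p X d z n 0 \<noteq> 0"
proof (rule ccontr)
  assume "\<not> ?thesis"
  then have zero: "moment p X d z (n + 2) 0 = 0" for n by auto
  define \<tau> where "\<tau> x = 1 / (z - of_real x)" for x
  define w where "w x = complex_of_real (d x * cmod (z - of_real x) powr (-p))" for x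
  have ne: "z - of_real x \<noteq> 0" if "x \<in> X" for x using z that by auto
  obtain x0 where x0: "x0 \<in> X" using X by blast
  define P where "P = (\<Prod>y\<in>X - {x0}. [:- \<tau> y, 1:])"
  have "0 = (\<Sum>n\<le>degree P. coeff P n * moment p X d z (n + 2) 0)"
    by (simp only: zero mult_zero_right sum.neutral_const)
  also have "\<dots> = (\<Sum>n\<le>degree P. \<Sum>x\<in>X. w x * \<tau> x ^ 2 * (coeff P n * \<tau> x ^ n))"
    unfolding moment_def w_def[symmetric] \<tau>_def[symmetric] sum_distrib_left
    by (simp add: power_add power2_eq_square mult_ac)
  also have "\<dots> = (\<Sum>x\<in>X. w x * \<tau> x ^ 2 * poly P (\<tau> x))"
    unfolding poly_altdef sum_distrib_left by (rule sum.swap)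
  also have "\<dots> = w x0 * \<tau> x0 ^ 2 * poly P (\<tau> x0)"
  proof -
    have "poly P (\<tau> x) = 0" if "x \<in> X - {x0}" for x
      using that X by (auto simp: P_def poly_prod)
    then show ?thesis using X x0 by (simp add: sum.remove)
  qed
  finally have "w x0 * \<tau> x0 ^ 2 * poly P (\<tau> x0) = 0" by simp
  moreover have "w x0 \<noteq> 0" using ne[OF x0] d[OF x0] by (simp add: w_def)
  moreover have "\<tau> x0 \<noteq> 0" using ne[OF x0] by (simp add: \<tau>_def)
  moreover have "poly P (\<tau> x0) \<noteq> 0"
    using X ne x0 by (auto simp: P_def poly_prod \<tau>_def)
  ultimately show False by simp
qed

section \<open>Critical points are saddles\<close>

lemma saddleI:
  assumes "Im (cnj u1 * u3) \<noteq> 0" "v = of_real s * u1 + of_real t * u3" "s > 0" "t > 0"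
    and "\<And>s t :: real. s \<ge> 0 \<Longrightarrow> t \<ge> 0 \<Longrightarrow> v' \<noteq> of_real s * u1 + of_real t * u3"
    and "eventually (\<lambda>h. z + of_real h * u1 \<in> superlevel p \<kappa> X d (potential p \<kappa> X d z)) (at_right 0)"
    and "eventually (\<lambda>h. z + of_real h * u3 \<in> superlevel p \<kappa> X d (potential p \<kappa> X d z)) (at_right 0)"
    and "eventually (\<lambda>h. potential p \<kappa> X d (z + of_real h * v) < potential p \<kappa> X d z) (at_right 0)"
    and "eventually (\<lambda>h. potential p \<kappa> X d (z + of_real h * v') < potential p \<kappa> X d z \<or>
            Im (z + of_real h * v') < 0) (at_right 0)"
  shows "saddle p \<kappa> X d z"
proof -
  let ?U = "potential p \<kappa> X d"
  have "eventually (\<lambda>h. z + of_real h * u1 \<in> superlevel p \<kappa> X d (?U z) \<and>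
      z + of_real h * u3 \<in> superlevel p \<kappa> X d (?U z) \<and>
      ?U (z + of_real h * v) < ?U z \<and>
      (?U (z + of_real h * v') < ?U z \<or> Im (z + of_real h * v') < 0)) (at_right 0)"
    using assms(6-9) by eventually_elim blast
  then obtain b where b: "b > 0" "\<And>h. 0 < h \<Longrightarrow> h < b \<Longrightarrow> z + of_real h * u1 \<in> superlevel p \<kappa> X d (?U z) \<and>
      z + of_real h * u3 \<in> superlevel p \<kappa> X d (?U z) \<and>
      ?U (z + of_real h * v) < ?U z \<and>
      (?U (z + of_real h * v') < ?U z \<or> Im (z + of_real h * v') < 0)"
    unfolding eventually_at_right_field by blast
  show ?thesis
    unfolding saddle_def
  proof (rule exI[of _ u1], rule exI[of _ u3], rule exI[of _ v], rule exI[of _ v'], intro conjI)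
    show "\<exists>e>0. \<forall>h. 0 < h \<and> h \<le> e \<longrightarrow> z + of_real h * u1 \<in> superlevel p \<kappa> X d (?U z) \<and>
      z + of_real h * u3 \<in> superlevel p \<kappa> X d (?U z) \<and>
      ?U (z + of_real h * v) < ?U z \<and>
      (?U (z + of_real h * v') < ?U z \<or> Im (z + of_real h * v') < 0)"
      using b by (intro exI[of _ "b / 2"]) auto
    show "\<exists>s>0. \<exists>t>0. v = of_real s * u1 + of_real t * u3" using assms(2-4) by blast
    show "Im (cnj u1 * u3) \<noteq> 0" by fact
    show "\<forall>s\<ge>0. \<forall>t\<ge>0. v' \<noteq> of_real s * u1 + of_real t * u3" using assms(5) by blast
  qed
qed

text \<open>
  The leading term in the direction u is 2 Re (c u^n) with n \<ge> 2 and c \<noteq> 0, whose signs alternate at least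
  four times around z.
\<close>

lemma critical_saddle_off_axis:
  assumes p: "p > 0" and X: "finite X" "X \<noteq> {}" and d: "\<And>x. x \<in> X \<Longrightarrow> d x \<noteq> 0"
    and z: "Im z > 0" and crit: "critical p \<kappa> X d z"
  shows "saddle p \<kappa> X d z"
proof -
  define m where "m = moment p X d z"
  define B where "B k = (-(p/2) gchoose k)" for k
  have B0: "B k \<noteq> 0" for k
    using p unfolding B_def by (simp add: gbinomial_prod_rev add_pos_nonneg)
  have z': "z \<in> charge_free X" using z by (auto simp: charge_free_def)
  \<comment> \<open>All moments of total degree between 2 and n vanish, except the two pure ones of degree n.\<close>
  define n where "n = (LEAST n. 2 \<le> n \<and> m n 0 \<noteq> 0)"
  have ex: "\<exists>n. 2 \<le> n \<and> m n 0 \<noteq> 0"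
    using moment_nonzero[of X d z p] X d z' by (auto simp: m_def charge_free_def)
  have n: "2 \<le> n" "m n 0 \<noteq> 0" using LeastI_ex[OF ex] by (auto simp: n_def)
  have pure: "m k 0 = 0" if "2 \<le> k" "k < n" for k
    using not_less_Least[of k "\<lambda>n. 2 \<le> n \<and> m n 0 \<noteq> 0"] that by (auto simp: n_def)
  have m_cnj: "m k l = cnj (m l k)" for k l by (simp add: m_def moment_cnj)
  have mixed: "m (Suc k) (Suc l) = 0" if "Suc k + Suc l \<le> n" for k l
    using that
  proof (induction "k + l" arbitrary: k l rule: less_induct)
    case less
    have "m (Suc k) l = m k (Suc l)"
    proof (cases "k = 0 \<and> l = 0")
      case True
      have "m (Suc 0) 0 = of_real (\<kappa> / p)" using crit by (simp add: critical_def m_def)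
      then show ?thesis using True m_cnj[of 0 "Suc 0"] by simp
    next
      case False
      have "m (Suc k) l = 0"
      proof (cases l)
        case 0
        then show ?thesis using False less.prems by (intro pure[of "Suc k", folded 0]) auto
      next
        case (Suc l')
        then show ?thesis using less by simp
      qed
      moreover have "m k (Suc l) = 0"
      proof (cases k)
        case 0
        then show ?thesis using False less.prems pure[of "Suc l"] m_cnj[of 0 "Suc l"] by auto
      next
        case (Suc k')
        then show ?thesis using less by simp
      qed
      ultimately show ?thesis by simp
    qed
    then show ?case using z moment_mixed[of z p X d k l] by (simp add: m_def)
  qed
  have mixed': "m k (j - k) = 0" if "0 < k" "k < j" "j \<le> n" for k j
    using mixed[of "k - 1" "j - k - 1"] that by (simp add: Suc_diff_Suc)
  have low: "ray_coeff p X d z u j = 0" if "2 \<le> j" "j < n" for u j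
  proof -
    have "m k (j - k) = 0" if "k \<le> j" for k
      using mixed'[of k j] pure[OF \<open>2 \<le> j\<close> \<open>j < n\<close>] m_cnj[of 0 j] that \<open>j < n\<close>
      by (cases "k = 0"; cases "k = j") auto
    then show ?thesis by (simp add: ray_coeff_def m_def)
  qed
  define c where "c = of_real (B n) * m n 0"
  have c: "c \<noteq> 0" using B0 n by (simp add: c_def)
  have lead: "ray_coeff p X d z u n = 2 * Re (c * u ^ n)" for u
  proof -
    define T where "T k = of_real (B k * B (n - k)) * m k (n - k) * u ^ k * cnj u ^ (n - k)" for k
    have "(\<Sum>k\<le>n. T k) = (\<Sum>k\<in>{0, n}. T k)"
      by (rule sum.mono_neutral_right) (use mixed' in \<open>auto simp: T_def\<close>)
    also have "\<dots> = T n + T 0" using n by simp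
    also have "T n = c * u ^ n" by (simp add: T_def c_def B_def)
    also have "T 0 = cnj (c * u ^ n)" using m_cnj[of 0 n] by (simp add: T_def c_def B_def)
    finally have "Re (\<Sum>k\<le>n. T k) = 2 * Re (c * u ^ n)"
      by (simp only: plus_complex.sel cnj.simps mult_2)
    moreover have "ray_coeff p X d z u n = Re (\<Sum>k\<le>n. T k)"
      by (simp only: ray_coeff_def T_def B_def m_def)
    ultimately show ?thesis by simp
  qed
  \<comment> \<open>a direction of steepest descent\<close>
  define \<omega> where "\<omega> = cis ((pi - Arg c) / n)"
  have c\<omega>: "c * \<omega> ^ n = - of_real (cmod c)"
  proof -
    have "\<omega> ^ n = cis (pi - Arg c)" using n by (simp add: \<omega>_def Complex.DeMoivre)
    moreover have "c = of_real (cmod c) * cis (Arg c)"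
      using rcis_cmod_Arg[of c] by (simp add: rcis_def)
    ultimately have "c * \<omega> ^ n = of_real (cmod c) * (cis (Arg c) * cis (pi - Arg c))"
      by (metis mult.assoc)
    then show ?thesis by (simp add: cis_mult)
  qed
  have lead': "ray_coeff p X d z (\<omega> * cis \<phi>) n = - 2 * cmod c * cos (n * \<phi>)" for \<phi> :: real
  proof -
    have "c * (\<omega> * cis \<phi>) ^ n = c * \<omega> ^ n * cis (n * \<phi>)"
      by (simp add: power_mult_distrib Complex.DeMoivre)
    then show ?thesis unfolding lead c\<omega> by simp
  qed
  have sign: "eventually (\<lambda>h. z + of_real h * u \<notin> of_real ` X \<and>
     \<sigma> * (potential p \<kappa> X d (z + of_real h * u) - potential p \<kappa> X d z) > 0) (at_right 0)"
    if "\<sigma> * ray_coeff p X d z u n > 0" for \<sigma> u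
    by (rule potential_ray_sign[OF p X(1) z' crit n(1) low that])
  have up: "eventually (\<lambda>h. Im (z + of_real h * u) > 0) (at_right 0)" for u
  proof -
    have "((\<lambda>h. Im (z + of_real h * u)) \<longlongrightarrow> Im (z + of_real 0 * u)) (at_right 0)"
      by (intro tendsto_intros)
    then show ?thesis using z by (intro order_tendstoD(1)) auto
  qed
  have asc: "eventually (\<lambda>h. z + of_real h * (\<omega> * cis \<phi>) \<in> superlevel p \<kappa> X d (potential p \<kappa> X d z)) (at_right 0)"
    if "cos (n * \<phi>) < 0" for \<phi> :: real
  proof -
    have "1 * ray_coeff p X d z (\<omega> * cis \<phi>) n > 0"
      using that c by (simp add: lead' mult_pos_neg)
    from sign[OF this] up[of "\<omega> * cis \<phi>"]
    show ?thesis by eventually_elim (auto simp: superlevel_def charge_free_def)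
  qed
  have desc: "eventually (\<lambda>h. potential p \<kappa> X d (z + of_real h * (\<omega> * cis \<phi>)) < potential p \<kappa> X d z) (at_right 0)"
    if "cos (n * \<phi>) > 0" for \<phi> :: real
  proof -
    have "(-1) * ray_coeff p X d z (\<omega> * cis \<phi>) n > 0"
      using that c by (simp add: lead')
    from sign[OF this]
    show ?thesis by eventually_elim auto
  qed
  \<comment> \<open>The ascending directions are taken closer to the descent direction \<omega> than the steepest ascent at
    angle pi/n, so that the sector between them has an angle below pi even for n = 2.\<close>
  define \<psi> where "\<psi> = 3 * pi / (4 * n)"
  have n\<psi>: "n * \<psi> = pi - pi / 4" using n by (simp add: \<psi>_def field_simps)
  have \<psi>: "0 < \<psi>" "2 * \<psi> \<le> 3 * pi / 4"
    using n by (auto simp: \<psi>_def field_simps)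
  have cosn\<psi>: "cos (n * \<psi>) < 0" unfolding n\<psi> cos_pi_minus cos_45 by simp
  have cos\<psi>: "cos \<psi> > 0" using \<psi> pi_gt_zero by (intro cos_gt_zero_pi) linarith+
  have sin2\<psi>: "sin (2 * \<psi>) > 0" using \<psi> pi_gt_zero by (intro sin_gt_zero) linarith+
  have \<omega>1: "cnj \<omega> * \<omega> = 1" "\<omega> \<noteq> 0" by (simp_all add: \<omega>_def cis_cnj cis_mult)
  show ?thesis
  proof (rule saddleI)
    show "Im (cnj (\<omega> * cis (- \<psi>)) * (\<omega> * cis \<psi>)) \<noteq> 0"
    proof -
      have "cnj (\<omega> * cis (- \<psi>)) * (\<omega> * cis \<psi>) = (cnj \<omega> * \<omega>) * cis (2 * \<psi>)"
        by (simp add: cis_cnj cis_mult)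
      then show ?thesis using sin2\<psi> by (simp add: \<omega>1)
    qed
    show "\<omega> * cis 0 = of_real (1 / (2 * cos \<psi>)) * (\<omega> * cis (- \<psi>)) + of_real (1 / (2 * cos \<psi>)) * (\<omega> * cis \<psi>)"
    proof -
      have "cis (- \<psi>) + cis \<psi> = of_real (2 * cos \<psi>)" by (simp add: complex_eq_iff)
      then have "of_real (1 / (2 * cos \<psi>)) * \<omega> * (cis (- \<psi>) + cis \<psi>) = \<omega>"
        using cos\<psi> by simp
      then show ?thesis by (simp add: algebra_simps add_divide_distrib)
    qed
    show "1 / (2 * cos \<psi>) > 0" "1 / (2 * cos \<psi>) > 0" using cos\<psi> by auto
    show "\<omega> * cis (2 * pi / n) \<noteq> of_real s * (\<omega> * cis (- \<psi>)) + of_real t * (\<omega> * cis \<psi>)"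
      if "s \<ge> 0" "t \<ge> 0" for s t
    proof
      assume "\<omega> * cis (2 * pi / n) = of_real s * (\<omega> * cis (- \<psi>)) + of_real t * (\<omega> * cis \<psi>)"
      then have "\<omega> * cis (2 * pi / n) = \<omega> * (of_real s * cis (- \<psi>) + of_real t * cis \<psi>)"
        by (simp add: algebra_simps)
      then have "cis (2 * pi / n) * cis (- \<psi>) = (of_real s * cis (- \<psi>) + of_real t * cis \<psi>) * cis (- \<psi>)"
        using \<omega>1 by simp
      then have "cis (2 * pi / n - \<psi>) = of_real s * cis (- (2 * \<psi>)) + of_real t"
        by (simp add: distrib_right cis_mult mult.assoc)
      then have "Im (cis (2 * pi / n - \<psi>)) = Im (of_real s * cis (- (2 * \<psi>)) + of_real t)" by simp
      then have "sin (2 * pi / n - \<psi>) = - (s * sin (2 * \<psi>))" by simp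
      moreover have "2 * pi / n - \<psi> = (5 * pi / 4) / n" using n by (simp add: \<psi>_def field_simps)
      moreover have "sin ((5 * pi / 4) / n) > 0"
      proof (rule sin_gt_zero)
        show "5 * pi / 4 / n < pi" using n by (simp add: field_simps)
      qed (use n in auto)
      moreover have "s * sin (2 * \<psi>) \<ge> 0" using that sin2\<psi> by simp
      ultimately show False by simp
    qed
    show "eventually (\<lambda>h. z + of_real h * (\<omega> * cis (- \<psi>)) \<in> superlevel p \<kappa> X d (potential p \<kappa> X d z)) (at_right 0)"
      by (rule asc) (use cosn\<psi> in simp)
    show "eventually (\<lambda>h. z + of_real h * (\<omega> * cis \<psi>) \<in> superlevel p \<kappa> X d (potential p \<kappa> X d z)) (at_right 0)"
      by (rule asc) (use cosn\<psi> in simp)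
    show "eventually (\<lambda>h. potential p \<kappa> X d (z + of_real h * (\<omega> * cis 0)) < potential p \<kappa> X d z) (at_right 0)"
      by (rule desc) simp
    have "eventually (\<lambda>h. potential p \<kappa> X d (z + of_real h * (\<omega> * cis (2 * pi / n))) < potential p \<kappa> X d z) (at_right 0)"
      by (rule desc) (use n in simp)
    then show "eventually (\<lambda>h. potential p \<kappa> X d (z + of_real h * (\<omega> * cis (2 * pi / n))) < potential p \<kappa> X d z \<or>
        Im (z + of_real h * (\<omega> * cis (2 * pi / n))) < 0) (at_right 0)"
      by eventually_elim simp
  qed
qed

text \<open>
  For real z all moments of the same total degree coincide, and the leading term in the direction
  exp(i \<theta>) is a multiple of a Gegenbauer function of degree at least 3. Three directions in the open upper half
  plane with alternating signs are provided by Sturm comparison; the fourth one is -i.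
\<close>

lemma critical_saddle_on_axis:
  assumes p: "p > 0" and X: "finite X" "X \<noteq> {}" and d: "\<And>x. x \<in> X \<Longrightarrow> d x \<noteq> 0"
    and z: "Im z = 0" "z \<in> charge_free X" and crit: "critical p \<kappa> X d z"
  shows "saddle p \<kappa> X d z"
proof -
  define m where "m = moment p X d z"
  have cnj_z: "cnj z = z" using z by (simp add: complex_eq_iff)
  have m_add: "m k l = m (k + l) 0" for k l
    by (simp add: m_def moment_def cnj_z power_add mult_ac)
  have m_real: "m k 0 = of_real (Re (m k 0))" for k
  proof -
    have "cnj (m k 0) = m k 0" using m_add[of 0 k] by (simp add: m_def moment_cnj)
    then show ?thesis by (simp add: complex_eq_iff)
  qed
  define n where "n = (LEAST n. 2 \<le> n \<and> m n 0 \<noteq> 0)"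
  have ex: "\<exists>n. 2 \<le> n \<and> m n 0 \<noteq> 0"
    using moment_nonzero[of X d z p] X d z by (auto simp: m_def charge_free_def)
  have n: "2 \<le> n" "m n 0 \<noteq> 0" using LeastI_ex[OF ex] by (auto simp: n_def)
  have pure: "m k 0 = 0" if "2 \<le> k" "k < n" for k
    using not_less_Least[of k "\<lambda>n. 2 \<le> n \<and> m n 0 \<noteq> 0"] that by (auto simp: n_def)
  have "m 2 0 = 0" using crit m_add[of 1 1] by (simp add: critical_def m_def numeral_2_eq_2)
  then have n3: "n \<ge> 3" using n by (cases "n = 2") auto
  have low: "ray_coeff p X d z u j = 0" if "2 \<le> j" "j < n" for u j
  proof -
    have "m k (j - k) = 0" if "k \<le> j" for k
      using pure[OF \<open>2 \<le> j\<close> \<open>j < n\<close>] m_add[of k "j - k"] that by simp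
    then show ?thesis by (simp add: ray_coeff_def m_def)
  qed
  have lead: "ray_coeff p X d z (cis \<theta>) n = Re (m n 0) * gegenbauer (p/2) n \<theta>" for \<theta>
  proof -
    have eq: "of_real (b :: real) * m k (n - k) * cis \<theta> ^ k * cnj (cis \<theta>) ^ (n - k) =
       of_real (Re (m n 0)) * of_real b * cis ((real k - real (n - k)) * \<theta>)" if "k \<le> n" for k b
    proof -
      have "cis \<theta> ^ k * cnj (cis \<theta>) ^ (n - k) = cis (real k * \<theta> + real (n - k) * (- \<theta>))"
        by (simp only: cis_cnj Complex.DeMoivre cis_mult)
      also have "real k * \<theta> + real (n - k) * (- \<theta>) = (real k - real (n - k)) * \<theta>"
        by (simp only: left_diff_distrib mult_minus_right add_uminus_conv_diff)
      finally show ?thesis using m_real[of n] m_add[of k "n - k"] that by (simp add: mult_ac)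
    qed
    have "Re (of_real b * m k (n - k) * cis \<theta> ^ k * cnj (cis \<theta>) ^ (n - k)) =
       Re (m n 0) * (b * cos ((real k - real (n - k)) * \<theta>))" if "k \<le> n" for k b
      unfolding eq[OF that] by simp
    then show ?thesis
      unfolding ray_coeff_def gegenbauer_def m_def[symmetric] Re_sum sum_distrib_left
      by (intro sum.cong refl) simp_all
  qed
  define \<epsilon> where "\<epsilon> = Re (m n 0)"
  have \<epsilon>: "\<epsilon> \<noteq> 0" using n m_real[of n] by (auto simp: \<epsilon>_def)
  obtain \<theta>1 \<theta>2 \<theta>3 where \<theta>: "0 < \<theta>1" "\<theta>1 < \<theta>2" "\<theta>2 < \<theta>3" "\<theta>3 < pi"
    and s: "\<epsilon> * gegenbauer (p/2) n \<theta>1 > 0" "\<epsilon> * gegenbauer (p/2) n \<theta>2 < 0" "\<epsilon> * gegenbauer (p/2) n \<theta>3 > 0"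
    using gegenbauer_alternating_signs[of "p/2" n \<epsilon>] p n3 \<epsilon> by auto
  have sign: "eventually (\<lambda>h. z + of_real h * u \<notin> of_real ` X \<and>
     \<sigma> * (potential p \<kappa> X d (z + of_real h * u) - potential p \<kappa> X d z) > 0) (at_right 0)"
    if "\<sigma> * ray_coeff p X d z u n > 0" for \<sigma> u
    by (rule potential_ray_sign[OF p X(1) z(2) crit n(1) low that])
  have asc: "eventually (\<lambda>h. z + of_real h * cis \<theta> \<in> superlevel p \<kappa> X d (potential p \<kappa> X d z)) (at_right 0)"
    if "\<epsilon> * gegenbauer (p/2) n \<theta> > 0" "0 < \<theta>" "\<theta> < pi" for \<theta>
  proof -
    have sin: "sin \<theta> > 0" using that by (intro sin_gt_zero)
    have "1 * ray_coeff p X d z (cis \<theta>) n > 0" using that by (simp add: lead \<epsilon>_def)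
    then have "eventually (\<lambda>h. z + of_real h * cis \<theta> \<notin> of_real ` X \<and>
       1 * (potential p \<kappa> X d (z + of_real h * cis \<theta>) - potential p \<kappa> X d z) > 0) (at_right 0)"
      by (rule sign)
    moreover have "eventually (\<lambda>h::real. h > 0) (at_right 0)" by (rule eventually_at_right_less)
    ultimately show ?thesis
      by eventually_elim (use z(1) sin in \<open>auto simp: superlevel_def charge_free_def\<close>)
  qed
  have sin_pos: "sin (\<theta>3 - \<theta>1) > 0" "sin (\<theta>3 - \<theta>2) > 0" "sin (\<theta>2 - \<theta>1) > 0"
    "sin \<theta>1 > 0" "sin \<theta>3 > 0"
    using \<theta> by (auto intro!: sin_gt_zero)
  show ?thesis
  proof (rule saddleI)
    show "Im (cnj (cis \<theta>1) * cis \<theta>3) \<noteq> 0"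
      using sin_pos by (simp add: cis_cnj cis_mult)
    show "cis \<theta>2 = of_real (sin (\<theta>3 - \<theta>2) / sin (\<theta>3 - \<theta>1)) * cis \<theta>1 +
           of_real (sin (\<theta>2 - \<theta>1) / sin (\<theta>3 - \<theta>1)) * cis \<theta>3"
    proof -
      have "sin (\<theta>3 - \<theta>1) * cos \<theta>2 = sin (\<theta>3 - \<theta>2) * cos \<theta>1 + sin (\<theta>2 - \<theta>1) * cos \<theta>3"
        "sin (\<theta>3 - \<theta>1) * sin \<theta>2 = sin (\<theta>3 - \<theta>2) * sin \<theta>1 + sin (\<theta>2 - \<theta>1) * sin \<theta>3"
        by (simp_all add: sin_diff algebra_simps)
      then show ?thesis using sin_pos by (simp add: complex_eq_iff field_simps)
    qed
    show "sin (\<theta>3 - \<theta>2) / sin (\<theta>3 - \<theta>1) > 0" "sin (\<theta>2 - \<theta>1) / sin (\<theta>3 - \<theta>1) > 0"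
      using sin_pos by auto
    show "- \<i> \<noteq> of_real s * cis \<theta>1 + of_real t * cis \<theta>3" if "s \<ge> 0" "t \<ge> 0" for s t
    proof
      assume "- \<i> = of_real s * cis \<theta>1 + of_real t * cis \<theta>3"
      then have "Im (- \<i>) = Im (of_real s * cis \<theta>1 + of_real t * cis \<theta>3)" by simp
      then have "-1 = s * sin \<theta>1 + t * sin \<theta>3" by simp
      moreover have "s * sin \<theta>1 \<ge> 0" "t * sin \<theta>3 \<ge> 0" using that sin_pos by auto
      ultimately show False by simp
    qed
    show "eventually (\<lambda>h. z + of_real h * cis \<theta>1 \<in> superlevel p \<kappa> X d (potential p \<kappa> X d z)) (at_right 0)"
      using \<theta> s by (intro asc) auto
    show "eventually (\<lambda>h. z + of_real h * cis \<theta>3 \<in> superlevel p \<kappa> X d (potential p \<kappa> X d z)) (at_right 0)"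
      using \<theta> s by (intro asc) auto
    have "(-1) * ray_coeff p X d z (cis \<theta>2) n > 0" using s by (simp add: lead \<epsilon>_def)
    from sign[OF this]
    show "eventually (\<lambda>h. potential p \<kappa> X d (z + of_real h * cis \<theta>2) < potential p \<kappa> X d z) (at_right 0)"
      by eventually_elim auto
    have "eventually (\<lambda>h::real. h > 0) (at_right 0)" by (rule eventually_at_right_less)
    then show "eventually (\<lambda>h. potential p \<kappa> X d (z + of_real h * (- \<i>)) < potential p \<kappa> X d z \<or>
        Im (z + of_real h * (- \<i>)) < 0) (at_right 0)"
      by eventually_elim (use z(1) in simp)
  qed
qed

lemma critical_saddle:
  assumes p: "p > 0" and \<kappa>: "\<kappa> > 0" and X: "finite X" and d: "\<And>x. x \<in> X \<Longrightarrow> d x \<noteq> 0"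
    and z: "z \<in> charge_free X" and crit: "critical p \<kappa> X d z"
  shows "saddle p \<kappa> X d z"
proof -
  have "X \<noteq> {}"
  proof
    assume "X = {}"
    then have "complex_of_real (\<kappa> / p) = 0" using crit by (simp add: critical_def moment_def)
    then show False using p \<kappa> by simp
  qed
  moreover have "Im z \<ge> 0" using z by (simp add: charge_free_def)
  ultimately show ?thesis
    using critical_saddle_on_axis[OF p X _ d _ z crit] critical_saddle_off_axis[OF p X _ d _ crit]
    by (cases "Im z = 0") auto
qed

section \<open>Counting critical points\<close>

text \<open>
  Reflection in the imaginary axis and reversal of all charges turns U into -U and preserves \<kappa>.
\<close>

lemma critical_reflect:
  assumes "critical p \<kappa> X d z"
  shows "critical p \<kappa> (uminus ` X) (\<lambda>x. - d (- x)) (- cnj z)"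
proof -
  have "moment p (uminus ` X) (\<lambda>x. - d (- x)) (- cnj z) k l = - ((-1) ^ (k + l) * moment p X d z l k)" for k l
  proof -
    have cm: "cmod (- cnj z + of_real x) = cmod (z - of_real x)" for x
    proof -
      have "- cnj z + of_real x = - cnj (z - of_real x)" by simp
      then show ?thesis by (metis norm_minus_cancel complex_mod_cnj)
    qed
    have pow: "(1 / (- cnj z + of_real x)) = - cnj (1 / (z - of_real x))" for x
    proof -
      have "- cnj z + of_real x = - cnj (z - of_real x)" by simp
      then show ?thesis by (simp only: complex_cnj_divide complex_cnj_one divide_minus_right)
    qed
    have "moment p (uminus ` X) (\<lambda>x. - d (- x)) (- cnj z) k l =
      (\<Sum>x\<in>X. of_real (- d x * cmod (- cnj z + of_real x) powr (-p)) *
      (1 / (- cnj z + of_real x)) ^ k * cnj (1 / (- cnj z + of_real x)) ^ l)"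
      unfolding moment_def by (subst sum.reindex) (auto simp: inj_on_def)
    also have "\<dots> = (\<Sum>x\<in>X. - ((-1) ^ (k + l) * (of_real (d x * cmod (z - of_real x) powr (-p)) *
      (1 / (z - of_real x)) ^ l * cnj (1 / (z - of_real x)) ^ k)))"
      unfolding pow cm
    proof (intro sum.cong refl)
      fix x
      define \<tau> where "\<tau> = 1 / (z - of_real x)"
      have "(- cnj \<tau>) ^ k = (-1) ^ k * cnj \<tau> ^ k" "(- \<tau>) ^ l = (-1) ^ l * \<tau> ^ l"
        by (rule power_minus)+
      then have "of_real (- d x * r) * (- cnj \<tau>) ^ k * cnj (- cnj \<tau>) ^ l =
        - ((-1) ^ (k + l) * (of_real (d x * r) * \<tau> ^ l * cnj \<tau> ^ k))" for r
        by (simp add: power_add mult_ac)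
      then show "of_real (- d x * cmod (z - of_real x) powr (-p)) * (- cnj (1 / (z - of_real x))) ^ k *
           cnj (- cnj (1 / (z - of_real x))) ^ l =
         - ((-1) ^ (k + l) * (of_real (d x * cmod (z - of_real x) powr (-p)) * (1 / (z - of_real x)) ^ l *
           cnj (1 / (z - of_real x)) ^ k))"
        unfolding \<tau>_def .
    qed
    finally show ?thesis by (simp add: moment_def sum_negf sum_distrib_left)
  qed
  then show ?thesis using assms moment_cnj[of p X d z 1 0] by (simp add: critical_def)
qed

text \<open>
  The number of critical points is bounded by the number of positive charges and, by reflection, by the number of
  negative ones.
\<close>

theorem twice_card_critical_le_card_charges:
  assumes p: "p > 0" and \<kappa>: "\<kappa> > 0" and X: "finite X" and d: "\<And>x. x \<in> X \<Longrightarrow> d x \<noteq> 0"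
    and Z: "finite Z" "Z \<subseteq> charge_free X" "\<And>z. z \<in> Z \<Longrightarrow> critical p \<kappa> X d z"
  shows "2 * card Z \<le> card X"
proof -
  have pos: "card Z \<le> card {x \<in> X. d x > 0}"
    using Z critical_saddle[OF p \<kappa> X d] by (intro card_saddles_le_positive_charges[OF p \<kappa> X d]) auto
  let ?X = "uminus ` X" and ?d = "\<lambda>x. - d (- x)" and ?Z = "(\<lambda>z. - cnj z) ` Z"
  have d': "?d x \<noteq> 0" if "x \<in> ?X" for x using that d by auto
  have X': "finite ?X" using X by simp
  have free: "z \<in> charge_free ?X" if zZ: "z \<in> ?Z" for z
  proof -
    obtain w where w: "w \<in> Z" "z = - cnj w" using zZ by auto
    have "w = of_real x" if "z = of_real (- x)" for x using that w by (simp add: complex_eq_iff)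
    then show ?thesis using w Z(2) by (force simp: charge_free_def)
  qed
  have "card ?Z \<le> card {x \<in> ?X. ?d x > 0}"
    using Z free critical_reflect critical_saddle[OF p \<kappa> X' d']
    by (intro card_saddles_le_positive_charges[OF p \<kappa> X' d']) auto
  moreover have "card ?Z = card Z" by (intro card_image) (auto simp: inj_on_def)
  moreover have "{x \<in> ?X. ?d x > 0} = uminus ` {x \<in> X. d x < 0}" by auto
  then have "card {x \<in> ?X. ?d x > 0} = card {x \<in> X. d x < 0}" by (simp add: card_image)
  ultimately have neg: "card Z \<le> card {x \<in> X. d x < 0}" by simp
  have "{x \<in> X. d x > 0} \<union> {x \<in> X. d x < 0} = X" using d by (auto simp: neq_iff)
  then have "card X = card {x \<in> X. d x > 0} + card {x \<in> X. d x < 0}"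
    using X by (subst card_Un_disjoint[symmetric]) auto
  then show ?thesis using pos neg by simp
qed

section \<open>The dual system\<close>

text \<open>
  An inversion at a point x0 with c x0 \<noteq> 0 turns the two equations for z into the criticality of the image of z,
  for a potential whose charges are the images of the other points.
\<close>

theorem dual_system_bound:
  fixes c :: "real \<Rightarrow> real"
  assumes p: "p > 0" and Y: "finite Y" and Z: "finite Z" "Z \<subseteq> charge_free Y"
    and c: "\<exists>y\<in>Y. c y \<noteq> 0"
    and eq0: "\<And>z. z \<in> Z \<Longrightarrow> (\<Sum>y\<in>Y. c y * cmod (z - of_real y) powr (-(p+2))) = 0"
    and eq1: "\<And>z. z \<in> Z \<Longrightarrow> (\<Sum>y\<in>Y. c y * (y * cmod (z - of_real y) powr (-(p+2)))) = 0"
  shows "2 * card Z < card Y"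
proof -
  obtain x0 where x0: "x0 \<in> Y" "c x0 \<noteq> 0" using c by blast
  \<comment> \<open>The normalisation makes the uniform field point to the right.\<close>
  define e where "e y = sgn (c x0) * c y" for y
  have e0: "e x0 > 0" using x0 by (auto simp: e_def sgn_if)
  define Y' where "Y' = {y \<in> Y - {x0}. c y \<noteq> 0}"
  define \<xi> where "\<xi> y = 1 / (y - x0)" for y
  define \<zeta> where "\<zeta> z = 1 / cnj (z - of_real x0)" for z
  define X where "X = \<xi> ` Y'"
  define d where "d t = e (x0 + 1 / t) * \<bar>t\<bar> powr (p+2) / t" for t
  define K where "K z y = cmod (z - of_real y) powr (-(p+2))" for z y
  have Y': "finite Y'" "card Y' < card Y"
  proof -
    show "finite Y'" using Y by (simp add: Y'_def)
    have "Y' \<subset> Y" using x0 by (auto simp: Y'_def)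
    then show "card Y' < card Y" using Y by (rule psubset_card_mono[rotated])
  qed
  have inj_\<xi>: "inj_on \<xi> Y'" by (auto simp: inj_on_def \<xi>_def)
  have inj_\<zeta>: "inj_on \<zeta> Z" by (auto simp: inj_on_def \<zeta>_def)
  have ne: "y - x0 \<noteq> 0" if "y \<in> Y'" for y using that by (auto simp: Y'_def)
  have ne': "z - of_real y \<noteq> 0" if "z \<in> Z" "y \<in> Y" for z y using Z that by (auto simp: charge_free_def)
  have d_\<xi>: "d (\<xi> y) = e y * \<bar>\<xi> y\<bar> powr (p+2) / \<xi> y" for y by (simp add: d_def \<xi>_def)
  have diff: "\<zeta> z - of_real (\<xi> y) = (of_real y - cnj z) / (cnj (z - of_real x0) * of_real (y - x0))"
    if "z \<in> Z" "y \<in> Y'" for z y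
  proof -
    define A where "A = cnj (z - of_real x0)"
    define B where "B = complex_of_real (y - x0)"
    have "A \<noteq> 0" using ne'[OF that(1) x0(1)] unfolding A_def complex_cnj_zero_iff .
    moreover have "B \<noteq> 0" using ne[OF that(2)] by (simp only: B_def of_real_eq_0_iff not_False_eq_True)
    ultimately have "1 / A - 1 / B = (B - A) / (A * B)" by (simp add: field_simps)
    moreover have "B - A = of_real y - cnj z" by (simp add: A_def B_def)
    moreover have "of_real (\<xi> y) = 1 / B" by (simp add: \<xi>_def B_def)
    ultimately show ?thesis unfolding \<zeta>_def A_def[symmetric] B_def[symmetric] by simp
  qed
  have dist: "cmod (\<zeta> z - of_real (\<xi> y)) = cmod (z - of_real y) / (cmod (z - of_real x0) * \<bar>y - x0\<bar>)"
    if "z \<in> Z" "y \<in> Y'" for z y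
  proof -
    have "cmod (of_real y - cnj z) = cmod (cnj (of_real y - z))" by simp
    also have "\<dots> = cmod (z - of_real y)" by (simp only: complex_mod_cnj norm_minus_commute)
    finally show ?thesis unfolding diff[OF that] norm_divide norm_mult complex_mod_cnj norm_of_real by simp
  qed
  \<comment> \<open>covariance of the kernel under the inversion\<close>
  have kernel: "\<bar>\<xi> y\<bar> powr (p+2) * cmod (\<zeta> z - of_real (\<xi> y)) powr (-(p+2)) = K z y / K z x0"
    if "z \<in> Z" "y \<in> Y'" for z y
  proof -
    have "\<bar>\<xi> y\<bar> powr (p+2) = \<bar>y - x0\<bar> powr (-(p+2))"
      unfolding powr_minus_divide using ne[OF that(2)] by (simp add: \<xi>_def powr_divide)
    then show ?thesis
      using ne[OF that(2)] ne'[OF that(1) x0(1)]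
      unfolding dist[OF that] K_def
      by (simp add: powr_divide powr_mult powr_minus divide_simps)
  qed
  have crit: "critical p (p * e x0) X d (\<zeta> z) \<and> \<zeta> z \<in> charge_free X" if z: "z \<in> Z" for z
  proof -
    have K0: "K z x0 > 0" using ne'[OF z x0(1)] by (simp add: K_def)
    have dist_ne: "\<zeta> z - of_real (\<xi> y) \<noteq> 0" if "y \<in> Y'" for y
    proof -
      have "cmod (\<zeta> z - of_real (\<xi> y)) \<noteq> 0"
        unfolding dist[OF z that] using ne[OF that] ne'[OF z x0(1)] ne'[OF z, of y] that by (auto simp: Y'_def)
      then show ?thesis by auto
    qed
    have Y'_sum: "(\<Sum>y\<in>Y'. f y * e y) = (\<Sum>y\<in>Y. f y * e y) - f x0 * e x0" for f :: "real \<Rightarrow> real"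
    proof -
      have "(\<Sum>y\<in>Y'. f y * e y) = (\<Sum>y\<in>Y - {x0}. f y * e y)"
        using Y by (intro sum.mono_neutral_left) (auto simp: Y'_def e_def)
      then show ?thesis using Y x0 by (simp add: sum.remove)
    qed
    have e_eq0: "(\<Sum>y\<in>Y. K z y * e y) = 0"
    proof -
      have "(\<Sum>y\<in>Y. K z y * e y) = sgn (c x0) * (\<Sum>y\<in>Y. c y * cmod (z - of_real y) powr (-(p+2)))"
        by (simp add: K_def e_def sum_distrib_left mult_ac)
      then show ?thesis by (simp only: eq0[OF z] mult_zero_right)
    qed
    have e_eq1: "(\<Sum>y\<in>Y. (y * K z y) * e y) = 0"
    proof -
      have "(\<Sum>y\<in>Y. (y * K z y) * e y) = sgn (c x0) * (\<Sum>y\<in>Y. c y * (y * cmod (z - of_real y) powr (-(p+2))))"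
        by (simp add: K_def e_def sum_distrib_left mult_ac)
      then show ?thesis by (simp only: eq1[OF z] mult_zero_right)
    qed
    define L where "L t = cmod (\<zeta> z - of_real t) powr (-(p+2))" for t
    have S0: "(\<Sum>t\<in>X. d t * L t) = 0"
    proof -
      have "(\<Sum>t\<in>X. d t * L t) = (\<Sum>y\<in>Y'. d (\<xi> y) * L (\<xi> y))"
        unfolding X_def by (simp add: sum.reindex[OF inj_\<xi>])
      also have "\<dots> = (\<Sum>y\<in>Y'. (((y - x0) * K z y) * e y) / K z x0)"
      proof (intro sum.cong refl)
        fix y assume y: "y \<in> Y'"
        have "d (\<xi> y) * L (\<xi> y) = e y * (\<bar>\<xi> y\<bar> powr (p+2) * L (\<xi> y)) / \<xi> y" by (simp add: d_\<xi>)
        also have "\<dots> = e y * (K z y / K z x0) / \<xi> y" unfolding L_def kernel[OF z y] ..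
        also have "\<dots> = (((y - x0) * K z y) * e y) / K z x0" by (simp add: \<xi>_def)
        finally show "d (\<xi> y) * L (\<xi> y) = (((y - x0) * K z y) * e y) / K z x0" .
      qed
      also have "\<dots> = (\<Sum>y\<in>Y'. ((y - x0) * K z y) * e y) / K z x0" by (simp add: sum_divide_distrib)
      also have "(\<Sum>y\<in>Y'. ((y - x0) * K z y) * e y) = (\<Sum>y\<in>Y. ((y - x0) * K z y) * e y)"
        by (simp add: Y'_sum)
      also have "\<dots> = (\<Sum>y\<in>Y. (y * K z y) * e y) - x0 * (\<Sum>y\<in>Y. K z y * e y)"
        by (simp add: algebra_simps sum_subtractf sum_distrib_left)
      finally show ?thesis by (simp add: e_eq0 e_eq1)
    qed
    have S1: "(\<Sum>t\<in>X. d t * t * L t) = - e x0"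
    proof -
      have "(\<Sum>t\<in>X. d t * t * L t) = (\<Sum>y\<in>Y'. d (\<xi> y) * \<xi> y * L (\<xi> y))"
        unfolding X_def by (simp add: sum.reindex[OF inj_\<xi>])
      also have "\<dots> = (\<Sum>y\<in>Y'. (K z y * e y) / K z x0)"
      proof (intro sum.cong refl)
        fix y assume y: "y \<in> Y'"
        have "\<xi> y \<noteq> 0" using ne[OF y] by (simp add: \<xi>_def)
        then have "d (\<xi> y) * \<xi> y * L (\<xi> y) = e y * (\<bar>\<xi> y\<bar> powr (p+2) * L (\<xi> y))" by (simp add: d_\<xi>)
        also have "\<dots> = e y * (K z y / K z x0)" unfolding L_def kernel[OF z y] ..
        finally show "d (\<xi> y) * \<xi> y * L (\<xi> y) = (K z y * e y) / K z x0" by simp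
      qed
      also have "\<dots> = (\<Sum>y\<in>Y'. K z y * e y) / K z x0" by (simp add: sum_divide_distrib)
      also have "\<dots> = - e x0" using K0 by (simp add: Y'_sum e_eq0)
      finally show ?thesis .
    qed
    have X_ne: "\<zeta> z - of_real t \<noteq> 0" if "t \<in> X" for t using that dist_ne by (auto simp: X_def)
    have powr_L: "cmod (\<zeta> z - of_real t) powr (-p) = L t * (cmod (\<zeta> z - of_real t))\<^sup>2" if "t \<in> X" for t
    proof -
      have "cmod (\<zeta> z - of_real t) powr (-p) = cmod (\<zeta> z - of_real t) powr (-(p+2) + 2)" by simp
      also have "\<dots> = L t * cmod (\<zeta> z - of_real t) powr 2" unfolding powr_add L_def ..
      finally show ?thesis using X_ne[OF that] by simp
    qed
    have M0: "moment p X d (\<zeta> z) 1 0 = of_real (e x0)"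
    proof -
      have "moment p X d (\<zeta> z) 1 0 = (\<Sum>t\<in>X. of_real (d t * L t) * (cnj (\<zeta> z) - of_real t))"
        unfolding moment_def
      proof (intro sum.cong refl)
        fix t assume t: "t \<in> X"
        define w where "w = \<zeta> z - of_real t"
        have w: "w \<noteq> 0" using X_ne[OF t] by (simp add: w_def)
        have "of_real ((cmod w)\<^sup>2) * (1 / w) = cnj w"
          using w by (simp only: complex_norm_square) simp
        then have "of_real (d t * (L t * (cmod w)\<^sup>2)) * (1 / w) = of_real (d t * L t) * cnj w"
          by (simp only: of_real_mult mult.assoc)
        then show "of_real (d t * cmod (\<zeta> z - of_real t) powr (-p)) * (1 / (\<zeta> z - of_real t)) ^ 1 *
            cnj (1 / (\<zeta> z - of_real t)) ^ 0 = of_real (d t * L t) * (cnj (\<zeta> z) - of_real t)"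
          unfolding powr_L[OF t] by (simp add: w_def)
      qed
      also have "\<dots> = cnj (\<zeta> z) * of_real (\<Sum>t\<in>X. d t * L t) - of_real (\<Sum>t\<in>X. d t * t * L t)"
        by (simp add: algebra_simps sum_subtractf sum_distrib_left)
      finally show ?thesis by (simp add: S0 S1)
    qed
    have M1: "moment p X d (\<zeta> z) 1 1 = 0"
    proof -
      have "moment p X d (\<zeta> z) 1 1 = (\<Sum>t\<in>X. of_real (d t * L t))"
        unfolding moment_def
      proof (intro sum.cong refl)
        fix t assume t: "t \<in> X"
        define w where "w = \<zeta> z - of_real t"
        have w: "w \<noteq> 0" using X_ne[OF t] by (simp add: w_def)
        have "of_real ((cmod w)\<^sup>2) * (1 / w) * cnj (1 / w) = 1"
          using w by (simp only: complex_norm_square) simp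
        then have "of_real (d t * (L t * (cmod w)\<^sup>2)) * (1 / w) * cnj (1 / w) = of_real (d t * L t)"
          by (simp only: of_real_mult mult.assoc mult_1_right)
        then show "of_real (d t * cmod (\<zeta> z - of_real t) powr (-p)) * (1 / (\<zeta> z - of_real t)) ^ 1 *
            cnj (1 / (\<zeta> z - of_real t)) ^ 1 = of_real (d t * L t)"
          unfolding powr_L[OF t] by (simp add: w_def)
      qed
      also have "\<dots> = of_real (\<Sum>t\<in>X. d t * L t)" by simp
      finally show ?thesis by (simp add: S0)
    qed
    have "\<zeta> z = (z - of_real x0) / of_real ((cmod (z - of_real x0))\<^sup>2)"
      unfolding complex_norm_square \<zeta>_def using ne'[OF z x0(1)] by simp
    then have "Im (\<zeta> z) = Im z / (cmod (z - of_real x0))\<^sup>2" by (simp only: Im_divide_of_real) simp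
    moreover have "Im z \<ge> 0" using Z z by (auto simp: charge_free_def)
    ultimately have "Im (\<zeta> z) \<ge> 0" by simp
    then show ?thesis using p M0 M1 X_ne by (auto simp: critical_def charge_free_def)
  qed
  have "2 * card (\<zeta> ` Z) \<le> card X"
  proof (rule twice_card_critical_le_card_charges[OF p])
    show "p * e x0 > 0" using p e0 by simp
    show "d t \<noteq> 0" if t: "t \<in> X" for t
    proof -
      obtain y where y: "y \<in> Y'" "t = \<xi> y" using t by (auto simp: X_def)
      then have "e y \<noteq> 0" using x0 by (auto simp: e_def Y'_def sgn_if)
      then show ?thesis using ne[OF y(1)] by (simp add: y(2) d_\<xi>) (simp add: \<xi>_def)
    qed
  qed (use Z Y' crit in \<open>auto simp: X_def\<close>)
  also have "card X \<le> card Y'" unfolding X_def by (rule card_image_le) fact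
  also have "card (\<zeta> ` Z) = card Z" using inj_\<zeta> by (rule card_image)
  finally show ?thesis using Y' by simp
qed

section \<open>The Haar property\<close>

theorem theorem2:
  fixes p :: real and N :: nat and a b :: "nat \<Rightarrow> real"
    and R :: "nat \<Rightarrow> real \<Rightarrow> real" and D :: "real set"
  assumes "p > 0" and "N \<ge> 1"
    and "inj_on (\<lambda>j. (a j, \<bar>b j\<bar>)) {1..N}"
    and "\<And>j x. R j x = (x - a j)^2 + (b j)^2"
    and "D = UNIV - {a j | j. j \<in> {1..N} \<and> b j = 0}"
  shows "(\<forall>\<alpha> \<beta> :: nat \<Rightarrow> real. (\<exists>j\<in>{1..N}. \<alpha> j \<noteq> 0 \<or> \<beta> j \<noteq> 0) \<longrightarrow>
            (let Z = {x \<in> D. (\<Sum>j=1..N. \<alpha> j * R j x powr (-(p+2)/2)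
                               + \<beta> j * ((x - a j) * R j x powr (-(p+2)/2))) = 0}
             in finite Z \<and> card Z \<le> 2*N - 1))
       \<and> ((\<forall>j\<in>{1..N}. \<bar>b j\<bar> > 0) \<longrightarrow>
            haar_system ({1..N} <+> {1..N})
              (case_sum (\<lambda>j x. R j x powr (-(p+2)/2))
                        (\<lambda>j x. (x - a j) * R j x powr (-(p+2)/2))))"
proof -
  have zeros: "finite {x \<in> D. (\<Sum>j=1..N. \<alpha> j * R j x powr (-(p+2)/2)
                               + \<beta> j * ((x - a j) * R j x powr (-(p+2)/2))) = 0} \<and>
      card {x \<in> D. (\<Sum>j=1..N. \<alpha> j * R j x powr (-(p+2)/2)
                               + \<beta> j * ((x - a j) * R j x powr (-(p+2)/2))) = 0} \<le> 2 * N - 1"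
    (is "finite ?Z \<and> card ?Z \<le> _")
    if nontrivial: "\<exists>j\<in>{1..N}. \<alpha> j \<noteq> 0 \<or> \<beta> j \<noteq> 0" for \<alpha> \<beta> :: "nat \<Rightarrow> real"
  proof (rule ccontr)
    assume "\<not> ?thesis"
    then have "infinite ?Z \<or> 2 * N \<le> card ?Z" by auto
    then obtain Y where Y: "Y \<subseteq> ?Z" "finite Y" "card Y = 2 * N"
      by (meson infinite_arbitrarily_large obtain_subset_with_card_n)
    define z where "z j = Complex (a j) \<bar>b j\<bar>" for j
    have R_z: "R j x powr (-(p+2)/2) = cmod (z j - of_real x) powr (-(p+2))" for j x
    proof -
      have "cmod (z j - of_real x) = R j x powr (1/2)"
        using assms(4) by (simp add: z_def cmod_def powr_half_sqrt power2_commute)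
      then show ?thesis by (simp add: powr_powr)
    qed
    let ?I = "{1..N} <+> {1..N}"
    define F where "F = case_sum (\<lambda>j x. R j x powr (-(p+2)/2)) (\<lambda>j x. (x - a j) * R j x powr (-(p+2)/2))"
    have "\<exists>c. (\<exists>y\<in>Y. c y \<noteq> 0) \<and> (\<forall>i\<in>?I. (\<Sum>y\<in>Y. c y * F i y) = 0)"
    proof (rule square_system_transpose_kernel)
      show "card ?I = card Y" using Y by (simp add: card_Plus)
      show "\<exists>i\<in>?I. case_sum \<alpha> \<beta> i \<noteq> 0"
        using nontrivial by (metis InlI InrI old.sum.simps(5,6))
      show "(\<Sum>i\<in>?I. case_sum \<alpha> \<beta> i * F i y) = 0" if "y \<in> Y" for y
        using that Y by (auto simp: sum.Plus F_def sum.distrib)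
    qed (use Y in auto)
    then obtain c where c: "\<exists>y\<in>Y. c y \<noteq> 0" "\<And>i. i \<in> ?I \<Longrightarrow> (\<Sum>y\<in>Y. c y * F i y) = 0" by blast
    have "2 * card (z ` {1..N}) < card Y"
    proof (rule dual_system_bound[OF \<open>p > 0\<close> \<open>finite Y\<close> _ _ c(1)])
      show "z ` {1..N} \<subseteq> charge_free Y"
      proof
        fix w assume "w \<in> z ` {1..N}"
        then obtain j where j: "j \<in> {1..N}" "w = z j" by auto
        have "z j \<noteq> of_real y" if "y \<in> Y" for y
        proof
          assume "z j = of_real y"
          then have "y = a j" "b j = 0" by (auto simp: z_def complex_eq_iff)
          then show False using Y(1) that j assms(5) by auto
        qed
        then show "w \<in> charge_free Y" using j by (auto simp: charge_free_def z_def)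
      qed
      fix w assume "w \<in> z ` {1..N}"
      then obtain j where j: "j \<in> {1..N}" "w = z j" by auto
      have S0: "(\<Sum>y\<in>Y. c y * cmod (z j - of_real y) powr (-(p+2))) = 0"
        using c(2)[OF InlI[OF j(1)]] by (simp only: F_def sum.case R_z)
      have "(\<Sum>y\<in>Y. c y * ((y - a j) * cmod (z j - of_real y) powr (-(p+2)))) = 0"
        using c(2)[OF InrI[OF j(1)]] by (simp only: F_def sum.case R_z mult.assoc)
      moreover have "(\<Sum>y\<in>Y. c y * ((y - a j) * cmod (z j - of_real y) powr (-(p+2)))) =
         (\<Sum>y\<in>Y. c y * (y * cmod (z j - of_real y) powr (-(p+2)))) -
         a j * (\<Sum>y\<in>Y. c y * cmod (z j - of_real y) powr (-(p+2)))"
        by (simp add: sum_distrib_left sum_subtractf algebra_simps)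
      ultimately show "(\<Sum>y\<in>Y. c y * (y * cmod (w - of_real y) powr (-(p+2)))) = 0"
        using S0 j by simp
      show "(\<Sum>y\<in>Y. c y * cmod (w - of_real y) powr (-(p+2))) = 0" using S0 j by simp
    qed simp
    moreover have "inj_on z {1..N}"
    proof (rule inj_onI)
      fix i j assume ij: "i \<in> {1..N}" "j \<in> {1..N}" "z i = z j"
      then have "(a i, \<bar>b i\<bar>) = (a j, \<bar>b j\<bar>)" by (simp add: z_def)
      then show "i = j" using inj_onD[OF assms(3)] ij by blast
    qed
    then have "card (z ` {1..N}) = N" by (simp add: card_image)
    ultimately show False using Y by simp
  qed
  moreover have "haar_system ({1..N} <+> {1..N})
              (case_sum (\<lambda>j x. R j x powr (-(p+2)/2)) (\<lambda>j x. (x - a j) * R j x powr (-(p+2)/2)))"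
    if b: "\<forall>j\<in>{1..N}. \<bar>b j\<bar> > 0"
  proof -
    have D: "D = UNIV" using b assms(5) by auto
    have R_ne: "R j x \<noteq> 0" if "j \<in> {1..N}" for j x
      using b that assms(4)[of j x] by (simp add: sum_power2_eq_zero_iff)
    have cont_R: "continuous_on UNIV (R j)" for j
      unfolding assms(4)[abs_def] by (intro continuous_intros)
    show ?thesis
      unfolding haar_system_def
    proof (intro conjI ballI allI impI)
      show "finite ({1..N} <+> {1..N})" by simp
      fix i assume "i \<in> {1..N} <+> {1..N}"
      then show "continuous_on UNIV (case_sum (\<lambda>j x. R j x powr (-(p+2)/2)) (\<lambda>j x. (x - a j) * R j x powr (-(p+2)/2)) i)"
        by (elim PlusE) (auto intro!: continuous_intros cont_R R_ne)
    next
      fix c :: "nat + nat \<Rightarrow> real" assume "\<exists>i\<in>{1..N} <+> {1..N}. c i \<noteq> 0"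
      then have "\<exists>j\<in>{1..N}. c (Inl j) \<noteq> 0 \<or> c (Inr j) \<noteq> 0" by (auto elim!: PlusE)
      note zeros[OF this]
      moreover have "(\<Sum>i\<in>{1..N} <+> {1..N}. c i * case_sum (\<lambda>j x. R j x powr (-(p+2)/2))
            (\<lambda>j x. (x - a j) * R j x powr (-(p+2)/2)) i x) =
          (\<Sum>j=1..N. c (Inl j) * R j x powr (-(p+2)/2) + c (Inr j) * ((x - a j) * R j x powr (-(p+2)/2)))" for x
        by (simp add: sum.Plus sum.distrib)
      moreover have "card ({1..N} <+> {1..N}) = 2 * N" by (simp add: card_Plus)
      ultimately show "finite {x. (\<Sum>i\<in>{1..N} <+> {1..N}. c i * case_sum (\<lambda>j x. R j x powr (-(p+2)/2))
            (\<lambda>j x. (x - a j) * R j x powr (-(p+2)/2)) i x) = 0}"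
        and "card {x. (\<Sum>i\<in>{1..N} <+> {1..N}. c i * case_sum (\<lambda>j x. R j x powr (-(p+2)/2))
            (\<lambda>j x. (x - a j) * R j x powr (-(p+2)/2)) i x) = 0} \<le> card ({1..N} <+> {1..N}) - 1"
        by (simp_all add: D)
    qed
  qed
  ultimately show ?thesis by (simp only: Let_def) blast
qed

end
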